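(* Every smooth irreducible genuine $k$-representation of $\widetilde T$ is finite-dimensional.
   Context: Let $p$ be an odd prime and $k$ an algebraically closed field of characteristic $p$. Let $G=\mathrm{GL}_2(\mathbb{Q}_p)$, $v$ the $p$-adic valuation, $\mu_2=\{\pm1\}$, $\omega\colon\mathbb{Q}_p^\times\to\mathbb{F}_p^\times$, $x\mapsto (xp^{-v(x)}\bmod p)$, Hilbert symbol $(a,b)=\omega\big((-1)^{v(a)v(b)}b^{v(a)}/a^{v(b)}\big)^{(p-1)/2}$. For $g=\begin{pmatrix}a&b\\c&d\end{pmatrix}$ put $\mathfrak c(g)=c$ if $c\neq0$, $\mathfrak c(g)=d$ if $c=0$. The metaplectic cover $\widetilde G$ is $G\times\mu_2$ with $(g_1,\zeta_1)(g_2,\zeta_2)=(g_1g_2,\zeta_1\zeta_2\sigma(g_1,g_2))$, $\sigma(g_1,g_2)=\big(\mathfrak c(g_1g_2)/\mathfrak c(g_1),\ \det(g_1)\mathfrak c(g_1g_2)/\mathfrak c(g_2)\big)$. $T$ is the diagonal torus and $\widetilde T$ its preimage in $\widetilde G$. $\iota\colon\mu_2\to k^\times$ is the nontrivial character; genuine means $\mu_2$ acts through $\iota$. *)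

theory Defs
  imports Main "HOL-Computational_Algebra.Polynomial"
begin

text \<open>p-adic integers Z_p as compatible sequences of residues modulo p^n.\<close>

type_synonym zp = "nat \<Rightarrow> int"

definition zp_carrier :: "int \<Rightarrow> zp set" where
  "zp_carrier p = {x. \<forall>n. 0 \<le> x n \<and> x n < p ^ n \<and> x n = x (Suc n) mod p ^ n}"

definition zp_units :: "int \<Rightarrow> zp set" where
  "zp_units p = {x \<in> zp_carrier p. x 1 \<noteq> 0}"

definition zp_mul :: "int \<Rightarrow> zp \<Rightarrow> zp \<Rightarrow> zp" where
  "zp_mul p x y = (\<lambda>n. (x n * y n) mod p ^ n)"

definition zp_inv :: "int \<Rightarrow> zp \<Rightarrow> zp" where
  "zp_inv p x = (\<lambda>n. THE y. 0 \<le> y \<and> y < p ^ n \<and> (x n * y) mod p ^ n = 1 mod p ^ n)"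

text \<open>The multiplicative group Q_p^x, realised as p^Z x Z_p^x: the pair (m, u) stands for p^m u.\<close>

type_synonym qpx = "int \<times> zp"

definition qpx_carrier :: "int \<Rightarrow> qpx set" where
  "qpx_carrier p = {(m, u). u \<in> zp_units p}"

definition qmul :: "int \<Rightarrow> qpx \<Rightarrow> qpx \<Rightarrow> qpx" where
  "qmul p x y = (fst x + fst y, zp_mul p (snd x) (snd y))"

definition qinv :: "int \<Rightarrow> qpx \<Rightarrow> qpx" where
  "qinv p x = (- fst x, zp_inv p (snd x))"

definition qone :: "int \<Rightarrow> qpx" where
  "qone p = (0, \<lambda>n. 1 mod p ^ n)"

definition qminus_one :: "int \<Rightarrow> qpx" where
  "qminus_one p = (0, \<lambda>n. p ^ n - 1)"

definition qpow :: "int \<Rightarrow> qpx \<Rightarrow> int \<Rightarrow> qpx" where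
  "qpow p x k = (if 0 \<le> k then ((qmul p x) ^^ nat k) (qone p)
                 else qinv p (((qmul p x) ^^ nat (- k)) (qone p)))"

text \<open>p-adic valuation v and omega(x) = (x p^{-v(x)} mod p), as an integer residue in {0..p-1}.\<close>

definition pval :: "qpx \<Rightarrow> int" where
  "pval x = fst x"

definition omega :: "qpx \<Rightarrow> int" where
  "omega x = snd x 1"

text \<open>Hilbert symbol (a,b) = omega((-1)^{v(a)v(b)} b^{v(a)} / a^{v(b)})^{(p-1)/2} in F_p^x,
  which lies in {1,-1}; we return it as the integer 1 or -1 (the group mu_2).\<close>

definition hilbert :: "int \<Rightarrow> qpx \<Rightarrow> qpx \<Rightarrow> int" where
  "hilbert p a b =
     (let x = qmul p (qpow p (qminus_one p) (pval a * pval b))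
                     (qmul p (qpow p b (pval a)) (qinv p (qpow p a (pval b))))
      in if (omega x ^ nat ((p - 1) div 2)) mod p = 1 then 1 else -1)"

text \<open>Elements of the metaplectic torus T~: ((a, d), zeta) stands for (diag(a,d), zeta) in G x mu_2.
  For diagonal g the entry c is 0, so c-frak(g) = d, and det g = a d.  The cocycle is
  sigma(g1,g2) = (c(g1g2)/c(g1), det(g1) c(g1g2)/c(g2)).\<close>

type_synonym ttilde = "(qpx \<times> qpx) \<times> int"

definition tt_carrier :: "int \<Rightarrow> ttilde set" where
  "tt_carrier p = {((a, d), z). a \<in> qpx_carrier p \<and> d \<in> qpx_carrier p \<and> z \<in> {1, -1}}"

definition tt_sigma :: "int \<Rightarrow> qpx \<times> qpx \<Rightarrow> qpx \<times> qpx \<Rightarrow> int" where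
  "tt_sigma p g1 g2 =
     (let (a1, d1) = g1; (a2, d2) = g2; c12 = qmul p d1 d2
      in hilbert p (qmul p c12 (qinv p d1))
                   (qmul p (qmul p (qmul p a1 d1) c12) (qinv p d2)))"

definition tt_mul :: "int \<Rightarrow> ttilde \<Rightarrow> ttilde \<Rightarrow> ttilde" where
  "tt_mul p x y =
     (let ((a1, d1), z1) = x; ((a2, d2), z2) = y
      in ((qmul p a1 a2, qmul p d1 d2), z1 * z2 * tt_sigma p (a1, d1) (a2, d2)))"

definition tt_one :: "int \<Rightarrow> ttilde" where
  "tt_one p = ((qone p, qone p), 1)"

text \<open>Neighbourhood basis of the identity of T~ (topology of G x mu_2):
  K_n = {(diag(a,d), 1) : a, d \<in> 1 + p^n Z_p}.\<close>

definition tt_K :: "int \<Rightarrow> nat \<Rightarrow> ttilde set" where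
  "tt_K p n = {((a, d), 1) | a d. a \<in> qpx_carrier p \<and> d \<in> qpx_carrier p \<and>
                 fst a = 0 \<and> fst d = 0 \<and> snd a n = 1 mod p ^ n \<and> snd d n = 1 mod p ^ n}"

text \<open>Representations of T~ on a k-vector space V (scalar multiplication scale).\<close>

definition is_rep :: "int \<Rightarrow> ('k::field \<Rightarrow> 'v::ab_group_add \<Rightarrow> 'v) \<Rightarrow> (ttilde \<Rightarrow> 'v \<Rightarrow> 'v) \<Rightarrow> bool" where
  "is_rep p scale \<rho> \<longleftrightarrow>
     (\<forall>g \<in> tt_carrier p. Vector_Spaces.linear scale scale (\<rho> g)) \<and>
     \<rho> (tt_one p) = id \<and>
     (\<forall>g \<in> tt_carrier p. \<forall>h \<in> tt_carrier p. \<rho> (tt_mul p g h) = \<rho> g \<circ> \<rho> h)"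

definition smooth_rep :: "int \<Rightarrow> (ttilde \<Rightarrow> 'v \<Rightarrow> 'v) \<Rightarrow> bool" where
  "smooth_rep p \<rho> \<longleftrightarrow> (\<forall>w. \<exists>n. \<forall>t \<in> tt_K p n. \<rho> t w = w)"

text \<open>Genuine: mu_2 acts through the nontrivial character iota, iota(-1) = -1.\<close>

definition genuine_rep :: "int \<Rightarrow> ('k::field \<Rightarrow> 'v::ab_group_add \<Rightarrow> 'v) \<Rightarrow> (ttilde \<Rightarrow> 'v \<Rightarrow> 'v) \<Rightarrow> bool" where
  "genuine_rep p scale \<rho> \<longleftrightarrow> (\<forall>w. \<rho> ((qone p, qone p), -1) w = scale (-1) w)"

definition irreducible_rep :: "int \<Rightarrow> ('k::field \<Rightarrow> 'v::ab_group_add \<Rightarrow> 'v) \<Rightarrow> (ttilde \<Rightarrow> 'v \<Rightarrow> 'v) \<Rightarrow> bool" where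
  "irreducible_rep p scale \<rho> \<longleftrightarrow>
     (\<exists>w::'v. w \<noteq> 0) \<and>
     (\<forall>S. module.subspace scale S \<and> (\<forall>g \<in> tt_carrier p. \<forall>w \<in> S. \<rho> g w \<in> S)
          \<longrightarrow> S = {0} \<or> S = UNIV)"

definition finite_dim :: "('k::field \<Rightarrow> 'v::ab_group_add \<Rightarrow> 'v) \<Rightarrow> bool" where
  "finite_dim scale \<longleftrightarrow> (\<exists>B. finite B \<and> module.span scale B = UNIV)"

definition alg_closed :: "'k::field itself \<Rightarrow> bool" where
  "alg_closed _ \<longleftrightarrow> (\<forall>q :: 'k poly. 0 < degree q \<longrightarrow> (\<exists>x. poly q x = 0))"

end

theory Submission
  imports "HOL-Number_Theory.Euler_Criterion" "Jordan_Normal_Form.Determinant" Defs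
begin

text \<open>
  For even exponents the diagonal elements \<open>diag(p\<^bsup>2a\<^esup>, p\<^bsup>2b\<^esup>)\<close> of \<open>T~\<close> are central, since the
  cocycle is trivial on them, so they act on \<open>V\<close> by intertwiners \<open>Q a b\<close>.  If \<open>w \<noteq> 0\<close> is fixed by
  \<open>K\<^sub>n\<close>, irreducibility makes \<open>V\<close> the span of the \<open>Q\<close>-translates of the finitely many vectors \<open>h w\<close>,
  \<open>h\<close> running over representatives of \<open>T~\<close> modulo \<open>K\<^sub>n\<close> and the central lattice.  By Schur's
  lemma every polynomial in \<open>X = Q 1 0\<close> and \<open>Y = Q 0 1\<close> acts as zero or invertibly, and a
  determinant-trick argument (Zariski's lemma for the finitely generated \<open>k[X\<^sup>\<plusminus>\<^sup>1, Y\<^sup>\<plusminus>\<^sup>1]\<close>-module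
  \<open>V\<close>) shows that \<open>X\<close> and \<open>Y\<close> are algebraic over \<open>k\<close>, hence scalar.  So the vectors \<open>h w\<close>
  span \<open>V\<close>.\<close>

section \<open>The determinant trick on localised spans\<close>

lemma comm_ring_hom_det_diag_minus:
  assumes "comm_ring_hom h" and "h \<pi> = 0"
  shows "h (det (c \<cdot>\<^sub>m 1\<^sub>m n - mat n n (\<lambda>(i, j). \<pi> * r i j))) = h c ^ n"
proof -
  interpret comm_ring_hom h by fact
  have "map_mat h (c \<cdot>\<^sub>m 1\<^sub>m n - mat n n (\<lambda>(i, j). \<pi> * r i j)) = h c \<cdot>\<^sub>m 1\<^sub>m n"
    by (rule eq_matI) (auto simp: hom_minus hom_mult hom_uminus assms(2))
  then have "det (map_mat h (c \<cdot>\<^sub>m 1\<^sub>m n - mat n n (\<lambda>(i, j). \<pi> * r i j))) = h c ^ n" by simp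
  then show ?thesis by simp
qed

text \<open>
  The vectors that a power of \<open>s\<close> moves into \<open>span W\<close>, i.e. those whose image in the
  localisation \<open>V\<^sub>s\<close> lies in the \<open>R\<^sub>s\<close>-span of \<open>W\<close>.\<close>

definition loc_span :: "('a::comm_ring_1 \<Rightarrow> 'b::ab_group_add \<Rightarrow> 'b) \<Rightarrow> 'a \<Rightarrow> 'b set \<Rightarrow> 'b set" where
  "loc_span scale s W = {v. \<exists>E. scale (s ^ E) v \<in> module.span scale W}"

context Modules.module
begin

lemma span_image_lessThan:
  fixes u :: "nat \<Rightarrow> 'b"
  shows "span (u ` {..<n}) = range (\<lambda>r. \<Sum>i<n. r i *s u i)"
proof
  show "range (\<lambda>r. \<Sum>i<n. r i *s u i) \<subseteq> span (u ` {..<n})"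
  proof clarify
    fix r show "(\<Sum>i<n. r i *s u i) \<in> span (u ` {..<n})"
      by (intro span_sum span_scale span_base) auto
  qed
  have "subspace (range (\<lambda>r. \<Sum>i<n. r i *s u i))"
    unfolding subspace_def
  proof (intro conjI ballI allI)
    show "0 \<in> range (\<lambda>r. \<Sum>i<n. r i *s u i)"
      by (rule range_eqI[where x="\<lambda>_. 0"]) simp
    fix x y assume "x \<in> range (\<lambda>r. \<Sum>i<n. r i *s u i)" "y \<in> range (\<lambda>r. \<Sum>i<n. r i *s u i)"
    then obtain r r' where "x = (\<Sum>i<n. r i *s u i)" "y = (\<Sum>i<n. r' i *s u i)" by blast
    then show "x + y \<in> range (\<lambda>r. \<Sum>i<n. r i *s u i)"
      by (intro range_eqI[where x="\<lambda>i. r i + r' i"]) (simp add: scale_left_distrib sum.distrib)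
  next
    fix c x assume "x \<in> range (\<lambda>r. \<Sum>i<n. r i *s u i)"
    then obtain r where "x = (\<Sum>i<n. r i *s u i)" by blast
    then show "c *s x \<in> range (\<lambda>r. \<Sum>i<n. r i *s u i)"
      by (intro range_eqI[where x="\<lambda>i. c * r i"]) (simp add: scale_sum_right)
  qed
  moreover have "u ` {..<n} \<subseteq> range (\<lambda>r. \<Sum>i<n. r i *s u i)"
  proof
    fix v assume "v \<in> u ` {..<n}"
    then obtain i where i: "i < n" "v = u i" by auto
    have "(\<Sum>j<n. (if i = j then 1 else 0) *s u j) = (\<Sum>j<n. if i = j then u j else 0)"
      by (rule sum.cong) auto
    then show "v \<in> range (\<lambda>r. \<Sum>i<n. r i *s u i)"
      using i by (intro range_eqI[where x="\<lambda>j. if i = j then 1 else 0"]) simp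
  qed
  ultimately show "span (u ` {..<n}) \<subseteq> range (\<lambda>r. \<Sum>i<n. r i *s u i)"
    by (rule span_minimal[rotated])
qed

lemma det_annihilates:
  fixes u :: "nat \<Rightarrow> 'b"
  assumes M: "M \<in> carrier_mat n n"
    and rel: "\<And>i. i < n \<Longrightarrow> c *s u i = (\<Sum>j<n. M $$ (i, j) *s u j)"
    and i: "i < n"
  shows "det (c \<cdot>\<^sub>m 1\<^sub>m n - M) *s u i = 0"
proof -
  define B where "B = c \<cdot>\<^sub>m 1\<^sub>m n - M"
  have B: "B \<in> carrier_mat n n" unfolding B_def using M by auto
  have B_entry: "B $$ (l, j) = (if l = j then c else 0) - M $$ (l, j)" if "l < n" "j < n" for l j
    unfolding B_def using M that by auto
  have B_rows: "(\<Sum>j<n. B $$ (l, j) *s u j) = 0" if l: "l < n" for l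
  proof -
    have "(\<Sum>j<n. B $$ (l, j) *s u j)
        = (\<Sum>j<n. (if l = j then c else 0) *s u j) - (\<Sum>j<n. M $$ (l, j) *s u j)"
      using l by (simp add: B_entry scale_left_diff_distrib sum_subtractf)
    also have "(\<Sum>j<n. (if l = j then c else 0) *s u j) = (\<Sum>j<n. if l = j then c *s u j else 0)"
      by (rule sum.cong) auto
    finally show ?thesis using rel[OF l] l by simp
  qed
  have adj: "adj_mat B * B = det B \<cdot>\<^sub>m 1\<^sub>m n" and adj_carrier: "adj_mat B \<in> carrier_mat n n"
    using adj_mat[OF B] by simp_all
  have "det B *s u i = (\<Sum>j<n. (adj_mat B * B) $$ (i, j) *s u j)"
  proof -
    have "(\<Sum>j<n. (adj_mat B * B) $$ (i, j) *s u j) = (\<Sum>j<n. if i = j then det B *s u j else 0)"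
      by (rule sum.cong) (use i in \<open>auto simp: adj\<close>)
    then show ?thesis using i by simp
  qed
  also have "\<dots> = (\<Sum>j<n. \<Sum>l<n. adj_mat B $$ (i, l) *s B $$ (l, j) *s u j)"
    using adj_carrier B i
    by (intro sum.cong refl) (simp add: scalar_prod_def atLeast0LessThan scale_sum_left)
  also have "\<dots> = (\<Sum>l<n. adj_mat B $$ (i, l) *s (\<Sum>j<n. B $$ (l, j) *s u j))"
    by (subst sum.swap) (simp add: scale_sum_right)
  also have "\<dots> = 0" by (simp add: B_rows)
  finally show ?thesis unfolding B_def .
qed

lemma scale_power_eq_0:
  assumes "\<And>v. s *s v = 0 \<Longrightarrow> v = 0" and "(s ^ E) *s v = 0"
  shows "v = 0"
  using assms(2)
proof (induction E arbitrary: v)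
  case (Suc E)
  then show ?case using assms(1)[of "(s ^ E) *s v"] by (simp add: mult.commute)
qed simp

lemma scale_power_in_span_mono:
  assumes "(s ^ E) *s v \<in> span W" and "E \<le> E'"
  shows "(s ^ E') *s v \<in> span W"
proof -
  have "(s ^ E') *s v = (s ^ (E' - E)) *s ((s ^ E) *s v)"
    using assms(2) by (simp flip: power_add)
  then show ?thesis using assms(1) by (simp only: span_scale)
qed

lemma subspace_loc_span: "subspace (loc_span scale s W)"
proof (rule subspaceI)
  show "0 \<in> loc_span scale s W" unfolding loc_span_def by (simp add: span_zero)
next
  fix x y assume "x \<in> loc_span scale s W" "y \<in> loc_span scale s W"
  then obtain E1 E2 where "(s ^ E1) *s x \<in> span W" "(s ^ E2) *s y \<in> span W"
    unfolding loc_span_def by blast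
  then have "(s ^ (E1 + E2)) *s x \<in> span W" "(s ^ (E1 + E2)) *s y \<in> span W"
    using scale_power_in_span_mono by auto
  then have "(s ^ (E1 + E2)) *s (x + y) \<in> span W"
    by (simp only: scale_right_distrib span_add)
  then show "x + y \<in> loc_span scale s W"
    unfolding loc_span_def by blast
next
  fix c x assume "x \<in> loc_span scale s W"
  then obtain E where "(s ^ E) *s x \<in> span W" unfolding loc_span_def by blast
  then have "(s ^ E) *s (c *s x) \<in> span W"
    by (simp only: scale_left_commute[of "s ^ E"] span_scale)
  then show "c *s x \<in> loc_span scale s W"
    unfolding loc_span_def by blast
qed

lemma span_subset_loc_span: "span W \<subseteq> loc_span scale s W"
  unfolding loc_span_def by (auto intro: exI[of _ 0])

lemma loc_span_closed:
  assumes T_add: "\<And>x y. T (x + y) = T x + T y" and T_scale: "\<And>c x. T (c *s x) = c *s T x"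
    and gen: "\<And>w. w \<in> W \<Longrightarrow> s *s T w \<in> span W"
    and v: "v \<in> loc_span scale s W"
  shows "T v \<in> loc_span scale s W"
proof -
  have T_zero: "T 0 = 0" using T_add[of 0 0] by simp
  have span_closed: "s *s T x \<in> span W" if "x \<in> span W" for x
    using that
  proof (induction rule: span_induct)
    show "subspace {x. s *s T x \<in> span W}"
    proof (rule subspaceI; simp)
      show "s *s T 0 \<in> span W" by (simp add: T_zero span_zero)
      show "s *s T (x + y) \<in> span W" if "s *s T x \<in> span W" "s *s T y \<in> span W" for x y
        using that by (simp add: T_add scale_right_distrib span_add)
      show "s *s T (c *s x) \<in> span W" if "s *s T x \<in> span W" for c x
        using that by (metis T_scale scale_left_commute span_scale)
    qed
  qed (rule gen)
  obtain E where "(s ^ E) *s v \<in> span W" using v unfolding loc_span_def by blast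
  then have "s *s T ((s ^ E) *s v) \<in> span W" by (rule span_closed)
  then have "(s ^ Suc E) *s T v \<in> span W" by (simp add: T_scale)
  then show ?thesis unfolding loc_span_def by blast
qed

lemma loc_span_uniform_exponent:
  assumes "finite F" and "F \<subseteq> loc_span scale s W"
  shows "\<exists>E. \<forall>v\<in>F. (s ^ E) *s v \<in> span W"
  using assms
proof (induction F rule: finite_induct)
  case (insert x F)
  obtain E1 where E1: "(s ^ E1) *s x \<in> span W" using insert.prems unfolding loc_span_def by blast
  obtain E2 where E2: "\<forall>v\<in>F. (s ^ E2) *s v \<in> span W" using insert by blast
  have "\<forall>v\<in>insert x F. (s ^ (E1 + E2)) *s v \<in> span W"
    using E1 E2 scale_power_in_span_mono[of s _ _ W "E1 + E2"] by auto
  then show ?case by blast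
qed simp

lemma loc_span_closed_inverse:
  assumes T_add: "\<And>x y. T (x + y) = T x + T y" and T_scale: "\<And>c x. T (c *s x) = c *s T x"
    and inverse: "\<And>v. x *s T v = v" and "x dvd s"
    and v: "v \<in> loc_span scale s W"
  shows "T v \<in> loc_span scale s W"
proof (rule loc_span_closed[OF T_add T_scale _ v])
  fix w assume "w \<in> W"
  obtain r where "s = x * r" using \<open>x dvd s\<close> by blast
  then have "s *s T w = r *s w" by (simp add: mult.commute inverse flip: scale_scale)
  then show "s *s T w \<in> span W" using \<open>w \<in> W\<close> by (simp add: span_base span_scale)
qed

lemma scale_eq_0_if_kills_loc_span:
  assumes kills: "\<And>w. w \<in> W \<Longrightarrow> d *s w = 0" and s_inj: "\<And>v. s *s v = 0 \<Longrightarrow> v = 0"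
    and v: "v \<in> loc_span scale s W"
  shows "d *s v = 0"
proof -
  have kills_span: "d *s x = 0" if "x \<in> span W" for x
    using that
  proof (induction rule: span_induct)
    show "subspace {x. d *s x = 0}"
    proof (rule subspaceI)
      show "x + y \<in> {x. d *s x = 0}" if "x \<in> {x. d *s x = 0}" "y \<in> {x. d *s x = 0}" for x y
        using that by (simp add: scale_right_distrib)
      show "c *s x \<in> {x. d *s x = 0}" if "x \<in> {x. d *s x = 0}" for c x
        using that scale_left_commute[of d c x] by simp
    qed simp
  qed (rule kills)
  obtain E where "(s ^ E) *s v \<in> span W" using v unfolding loc_span_def by blast
  then have "(s ^ E) *s (d *s v) = 0" by (simp only: scale_left_commute[of "s ^ E"] kills_span)
  then show ?thesis using scale_power_eq_0 s_inj by blast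
qed

text \<open>
  A determinant-trick annihilator: if \<open>V\<close> is finitely generated after inverting a
  non-zero-divisor \<open>s\<close> and \<open>\<pi>\<close> acts surjectively, some element congruent to a power of \<open>s\<close>
  modulo \<open>\<pi>\<close> annihilates \<open>V\<close>; the congruence is observed through a homomorphism \<open>h\<close> killing \<open>\<pi>\<close>.\<close>

lemma annihilator_congruent_to_power:
  assumes W: "finite W" and gen: "loc_span scale s W = UNIV"
    and s_inj: "\<And>v. s *s v = 0 \<Longrightarrow> v = 0"
    and \<pi>_surj: "surj ((*s) \<pi>)"
    and h: "comm_ring_hom h" "h \<pi> = 0"
  shows "\<exists>d m. (\<forall>v. d *s v = 0) \<and> h d = h s ^ m"
proof -
  obtain n and u :: "nat \<Rightarrow> 'b" where "W = u ` {i. i < n}"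
    using finite_imp_nat_seg_image_inj_on[OF W] by blast
  then have W_eq: "W = u ` {..<n}" by (simp add: lessThan_def)
  have "\<forall>i. \<exists>x. \<pi> *s x = u i" using \<pi>_surj by (metis surjD)
  then obtain z where z: "\<And>i. \<pi> *s z i = u i" by metis
  obtain E where E: "\<forall>v\<in>z ` {..<n}. (s ^ E) *s v \<in> span W"
    using loc_span_uniform_exponent[of "z ` {..<n}" s W] gen by auto
  then have "\<forall>i<n. \<exists>r. (s ^ E) *s z i = (\<Sum>j<n. r j *s u j)"
    unfolding W_eq span_image_lessThan by auto
  then obtain r where r: "\<And>i. i < n \<Longrightarrow> (s ^ E) *s z i = (\<Sum>j<n. r i j *s u j)" by metis
  define M where "M = mat n n (\<lambda>(i, j). \<pi> * r i j)"
  define d where "d = det ((s ^ E) \<cdot>\<^sub>m 1\<^sub>m n - M)"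
  have rel: "(s ^ E) *s u i = (\<Sum>j<n. M $$ (i, j) *s u j)" if i: "i < n" for i
  proof -
    have "(s ^ E) *s u i = \<pi> *s ((s ^ E) *s z i)" by (simp flip: z add: mult.commute)
    also have "\<dots> = (\<Sum>j<n. M $$ (i, j) *s u j)" using i by (simp add: r M_def scale_sum_right)
    finally show ?thesis .
  qed
  have kills_W: "d *s w = 0" if "w \<in> W" for w
  proof -
    obtain i where i: "i < n" "w = u i" using \<open>w \<in> W\<close> unfolding W_eq by blast
    have "M \<in> carrier_mat n n" unfolding M_def by simp
    then show ?thesis unfolding d_def i(2) by (rule det_annihilates[OF _ rel i(1)])
  qed
  have "d *s v = 0" for v
    using scale_eq_0_if_kills_loc_span[where W = W and d = d and v = v, OF _ s_inj] kills_W gen by blast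
  have "h d = h s ^ (E * n)"
  proof -
    interpret comm_ring_hom h by fact
    show ?thesis
      unfolding d_def M_def comm_ring_hom_det_diag_minus[OF h] by (simp add: hom_power power_mult)
  qed
  then show ?thesis using \<open>\<And>v. d *s v = 0\<close> by blast
qed

end

section \<open>Polynomials in an endomorphism\<close>

definition poly_act :: "('a::comm_ring_1 \<Rightarrow> 'b::ab_group_add \<Rightarrow> 'b) \<Rightarrow> ('b \<Rightarrow> 'b) \<Rightarrow> 'a poly \<Rightarrow> 'b \<Rightarrow> 'b" where
  "poly_act scale Z P v = (\<Sum>i\<le>degree P. scale (coeff P i) ((Z ^^ i) v))"

definition orbit_upto :: "('b \<Rightarrow> 'b) \<Rightarrow> 'b set \<Rightarrow> nat \<Rightarrow> 'b set" where
  "orbit_upto Z U D = {(Z ^^ j) u | u j. u \<in> U \<and> j < D}"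

lemma orbit_upto_eq_image: "orbit_upto Z U D = (\<lambda>(u, j). (Z ^^ j) u) ` (U \<times> {..<D})"
  unfolding orbit_upto_def by auto

lemma finite_orbit_upto: "finite U \<Longrightarrow> finite (orbit_upto Z U D)"
  unfolding orbit_upto_eq_image by simp

lemma subset_orbit_upto: "D \<noteq> 0 \<Longrightarrow> U \<subseteq> orbit_upto Z U D"
  unfolding orbit_upto_eq_image by (force intro: image_eqI[where x = "(_, 0)"])

locale module_endo = Modules.module +
  fixes Z :: "'b \<Rightarrow> 'b"
  assumes Z_add: "Z (x + y) = Z x + Z y"
    and Z_scale: "Z (a *s x) = a *s Z x"
begin

lemma Z_zero: "Z 0 = 0"
  using Z_add[of 0 0] by simp

lemma Z_sum: "Z (\<Sum>i\<in>S. f i) = (\<Sum>i\<in>S. Z (f i))"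
  by (induction S rule: infinite_finite_induct) (auto simp: Z_add Z_zero)

lemma funpow_Z_add: "(Z ^^ i) (x + y) = (Z ^^ i) x + (Z ^^ i) y"
  by (induction i) (auto simp: Z_add)

lemma poly_act_degree_le:
  assumes "degree P \<le> N"
  shows "poly_act scale Z P v = (\<Sum>i\<le>N. coeff P i *s (Z ^^ i) v)"
  unfolding poly_act_def
  by (rule sum.mono_neutral_left) (use assms in \<open>auto simp: coeff_eq_0\<close>)

lemma poly_act_add: "poly_act scale Z (P + Q) v = poly_act scale Z P v + poly_act scale Z Q v"
proof -
  define N where "N = max (degree P) (degree Q)"
  have "degree (P + Q) \<le> N" unfolding N_def by (rule degree_add_le) auto
  then have "poly_act scale Z (P + Q) v = (\<Sum>i\<le>N. coeff (P + Q) i *s (Z ^^ i) v)"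
    by (rule poly_act_degree_le)
  also have "\<dots> = (\<Sum>i\<le>N. coeff P i *s (Z ^^ i) v) + (\<Sum>i\<le>N. coeff Q i *s (Z ^^ i) v)"
    by (simp add: scale_left_distrib sum.distrib)
  also have "\<dots> = poly_act scale Z P v + poly_act scale Z Q v"
    by (simp add: poly_act_degree_le[symmetric] N_def)
  finally show ?thesis .
qed

lemma poly_act_0 [simp]: "poly_act scale Z 0 v = 0"
  unfolding poly_act_def by simp

lemma poly_act_pCons: "poly_act scale Z (pCons a P) v = a *s v + Z (poly_act scale Z P v)"
proof -
  have "poly_act scale Z (pCons a P) v = (\<Sum>i\<le>Suc (degree P). coeff (pCons a P) i *s (Z ^^ i) v)"
    by (rule poly_act_degree_le) (rule degree_pCons_le)
  also have "\<dots> = a *s v + (\<Sum>i\<le>degree P. coeff P i *s (Z ^^ Suc i) v)"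
    by (subst sum.atMost_Suc_shift) simp
  also have "(\<Sum>i\<le>degree P. coeff P i *s (Z ^^ Suc i) v) = Z (poly_act scale Z P v)"
    unfolding poly_act_def Z_sum by (simp add: Z_scale)
  finally show ?thesis .
qed

lemma poly_act_const: "poly_act scale Z [:a:] v = a *s v"
  by (simp add: poly_act_pCons Z_zero)

lemma poly_act_X: "poly_act scale Z [:0, 1:] v = Z v"
  by (simp add: poly_act_pCons poly_act_const Z_zero)

lemma poly_act_smult: "poly_act scale Z (smult a P) v = a *s poly_act scale Z P v"
proof -
  have "poly_act scale Z (smult a P) v = (\<Sum>i\<le>degree P. coeff (smult a P) i *s (Z ^^ i) v)"
    by (rule poly_act_degree_le) (rule degree_smult_le)
  then show ?thesis unfolding poly_act_def by (simp add: scale_sum_right)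
qed

lemma poly_act_mult: "poly_act scale Z (P * Q) v = poly_act scale Z P (poly_act scale Z Q v)"
proof (induction P arbitrary: v rule: pCons_induct)
  case (pCons a P)
  have "pCons a P * Q = smult a Q + pCons 0 (P * Q)" by simp
  then show ?case by (simp only: poly_act_add poly_act_smult poly_act_pCons pCons.IH) simp
qed simp

lemma poly_act_1: "poly_act scale Z 1 v = v"
  using poly_act_const[of 1 v] by (simp add: one_pCons)

lemma poly_act_right_distrib: "poly_act scale Z P (x + y) = poly_act scale Z P x + poly_act scale Z P y"
  unfolding poly_act_def by (simp add: funpow_Z_add scale_right_distrib sum.distrib)

lemma module_poly_act: "Modules.module (poly_act scale Z)"
  by unfold_locales (simp_all add: poly_act_add poly_act_mult poly_act_1 poly_act_right_distrib)

lemma poly_act_commute: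
  assumes T_add: "\<And>x y. T (x + y) = T x + T y"
    and T_scale: "\<And>a x. T (a *s x) = a *s T x" and T_Z: "\<And>x. T (Z x) = Z (T x)"
  shows "T (poly_act scale Z P v) = poly_act scale Z P (T v)"
proof -
  have T_zero: "T 0 = 0" using T_add[of 0 0] by simp
  have T_sum: "T (\<Sum>i\<in>S. f i) = (\<Sum>i\<in>S. T (f i))" for S and f :: "nat \<Rightarrow> 'b"
    by (induction S rule: infinite_finite_induct) (auto simp: T_add T_zero)
  have "T ((Z ^^ i) x) = (Z ^^ i) (T x)" for i x by (induction i) (auto simp: T_Z)
  then show ?thesis unfolding poly_act_def T_sum by (simp add: T_scale)
qed

lemma exists_annihilator_coeff_0_nonzero:
  assumes Z_inj: "\<And>v. Z v = 0 \<Longrightarrow> v = 0"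
    and "P \<noteq> 0" and "\<And>v. poly_act scale Z P v = 0"
  shows "\<exists>P. P \<noteq> 0 \<and> coeff P 0 \<noteq> 0 \<and> (\<forall>v. poly_act scale Z P v = 0)"
  using assms(2,3)
proof (induction P rule: pCons_induct)
  case (pCons a P)
  show ?case
  proof (cases "a = 0")
    case True
    have "Z (poly_act scale Z P v) = 0" for v
      using pCons.prems(2)[of v] True by (simp add: poly_act_pCons)
    then show ?thesis using pCons True Z_inj by auto
  next
    case False
    then show ?thesis using pCons.prems by (intro exI[of _ "pCons a P"]) auto
  qed
qed simp

lemma poly_act_split_top:
  "poly_act scale Z P v = (\<Sum>i<degree P. coeff P i *s (Z ^^ i) v) + lead_coeff P *s (Z ^^ degree P) v"
  unfolding poly_act_def by (simp add: lessThan_Suc_atMost[symmetric])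

text \<open>
  An annihilating polynomial lets \<open>Z\<close> and its inverse move the powers \<open>Z\<^sup>j u\<close>, \<open>j < degree P\<close>,
  into their span, up to its leading resp. constant coefficient.\<close>

lemma loc_span_closed_Z:
  assumes ann: "\<And>v. poly_act scale Z P v = 0" and "lead_coeff P dvd s"
    and v: "v \<in> loc_span scale s (orbit_upto Z U (degree P))"
  shows "Z v \<in> loc_span scale s (orbit_upto Z U (degree P))"
proof (rule loc_span_closed[OF Z_add Z_scale _ v])
  fix w assume "w \<in> orbit_upto Z U (degree P)"
  then obtain u j where w: "w = (Z ^^ j) u" and u: "u \<in> U" and j: "j < degree P"
    unfolding orbit_upto_def by auto
  have powers_in_span: "(Z ^^ i) u \<in> span (orbit_upto Z U (degree P))" if "i < degree P" for i
    using that u unfolding orbit_upto_def by (blast intro: span_base)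
  show "s *s Z w \<in> span (orbit_upto Z U (degree P))"
  proof (cases "Suc j < degree P")
    case True
    then show ?thesis unfolding w using powers_in_span[OF True] by (simp add: span_scale)
  next
    case False
    then have "degree P = Suc j" using j by simp
    then have top: "Z w = (Z ^^ degree P) u" unfolding w by simp
    obtain r where s: "s = lead_coeff P * r" using \<open>lead_coeff P dvd s\<close> by blast
    have "lead_coeff P *s (Z ^^ degree P) u = - (\<Sum>i<degree P. coeff P i *s (Z ^^ i) u)"
      using ann[of u] unfolding poly_act_split_top by (simp add: eq_neg_iff_add_eq_0 add.commute)
    then have "s *s Z w = r *s - (\<Sum>i<degree P. coeff P i *s (Z ^^ i) u)"
      unfolding top s by (simp add: mult.commute flip: scale_scale)
    also have "\<dots> \<in> span (orbit_upto Z U (degree P))"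
      by (intro span_scale span_neg span_sum powers_in_span) simp
    finally show ?thesis .
  qed
qed

lemma loc_span_closed_Z_inverse:
  assumes ann: "\<And>v. poly_act scale Z P v = 0" and "coeff P 0 dvd s"
    and Z_Z': "\<And>v. Z (Z' v) = v" and Z'_Z: "\<And>v. Z' (Z v) = v"
    and v: "v \<in> loc_span scale s (orbit_upto Z U (degree P))"
  shows "Z' v \<in> loc_span scale s (orbit_upto Z U (degree P))"
proof (rule loc_span_closed[OF _ _ _ v])
  show Z'_add: "Z' (x + y) = Z' x + Z' y" for x y
    by (metis Z_Z' Z'_Z Z_add)
  show "Z' (c *s x) = c *s Z' x" for c x
    by (metis Z_Z' Z'_Z Z_scale)
  fix w assume "w \<in> orbit_upto Z U (degree P)"
  then obtain u j where w: "w = (Z ^^ j) u" and u: "u \<in> U" and j: "j < degree P"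
    unfolding orbit_upto_def by auto
  have powers_in_span: "(Z ^^ i) u \<in> span (orbit_upto Z U (degree P))" if "i < degree P" for i
    using that u unfolding orbit_upto_def by (blast intro: span_base)
  show "s *s Z' w \<in> span (orbit_upto Z U (degree P))"
  proof (cases j)
    case (Suc i)
    then have "Z' w = (Z ^^ i) u" unfolding w by (simp add: Z'_Z)
    then show ?thesis using Suc j by (simp add: powers_in_span span_scale)
  next
    case 0
    then obtain D where D: "degree P = Suc D" using j by (metis gr0_implies_Suc)
    obtain r where s: "s = coeff P 0 * r" using \<open>coeff P 0 dvd s\<close> by blast
    have "poly_act scale Z P (Z' u) = coeff P 0 *s Z' u + (\<Sum>i\<le>D. coeff P (Suc i) *s (Z ^^ i) u)"
      unfolding poly_act_def D by (subst sum.atMost_Suc_shift) (simp add: funpow_swap1 Z_Z')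
    then have "coeff P 0 *s Z' u = - (\<Sum>i\<le>D. coeff P (Suc i) *s (Z ^^ i) u)"
      using ann[of "Z' u"] by (simp add: eq_neg_iff_add_eq_0)
    then have "s *s Z' w = r *s - (\<Sum>i\<le>D. coeff P (Suc i) *s (Z ^^ i) u)"
      unfolding w 0 s by (simp add: mult.commute flip: scale_scale)
    also have "\<dots> \<in> span (orbit_upto Z U (degree P))"
      by (intro span_scale span_neg span_sum powers_in_span) (simp add: D)
    finally show ?thesis .
  qed
qed

end

lemma eigenvector_from_annihilating_poly:
  fixes scale :: "'k::field \<Rightarrow> 'v::ab_group_add \<Rightarrow> 'v"
  assumes "module_endo scale Z" and "alg_closed TYPE('k)"
    and "q \<noteq> 0" and "poly_act scale Z q v = 0" and "v \<noteq> 0"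
  shows "\<exists>c w. w \<noteq> 0 \<and> Z w = scale c w"
  using assms(3-)
proof (induction "degree q" arbitrary: q v rule: less_induct)
  case less
  interpret module_endo scale Z by fact
  show ?case
  proof (cases "degree q = 0")
    case True
    then obtain a where q: "q = [:a:]" by (metis degree_0_id)
    then have "a \<noteq> 0" and "scale a v = 0" using less.prems by (simp_all add: poly_act_const)
    then have "v = 0" by (metis scale_one scale_scale field_class.field_inverse mult.commute scale_zero_right)
    then show ?thesis using less.prems by blast
  next
    case False
    then obtain c where "poly q c = 0" using assms(2) unfolding alg_closed_def by blast
    then obtain q1 where q: "q = [:- c, 1:] * q1" by (metis poly_eq_0_iff_dvd dvdE)
    have "q1 \<noteq> 0" using less.prems q by auto
    then have "degree q = degree [:- c, 1:] + degree q1" unfolding q by (intro degree_mult_eq) simp_all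
    then have degree_q1: "degree q1 < degree q" by simp
    define w where "w = poly_act scale Z q1 v"
    have "poly_act scale Z [:- c, 1:] w = 0"
      using less.prems(2) unfolding w_def q by (simp only: poly_act_mult)
    then have "Z w = scale c w"
      by (simp add: poly_act_pCons poly_act_const Z_zero add_eq_0_iff scale_minus_left)
    show ?thesis
    proof (cases "w = 0")
      case True
      then show ?thesis using less.hyps[OF degree_q1 \<open>q1 \<noteq> 0\<close>] less.prems(3) unfolding w_def by blast
    next
      case False
      then show ?thesis using \<open>Z w = scale c w\<close> by blast
    qed
  qed
qed

section \<open>Central lattice actions satisfying Schur's lemma\<close>

lemma alg_closed_infinite:
  assumes "alg_closed TYPE('k::field)"
  shows "infinite (UNIV :: 'k set)"
proof
  assume fin: "finite (UNIV :: 'k set)"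
  define q :: "'k poly" where "q = (\<Prod>a\<in>UNIV. [:- a, 1:]) + 1"
  have "degree (\<Prod>a\<in>UNIV. [:- a, 1:] :: 'k poly) = card (UNIV :: 'k set)"
    using fin by (subst degree_prod_eq_sum_degree) auto
  moreover have "card (UNIV :: 'k set) > 0" using fin by (simp add: finite_UNIV_card_ge_0)
  ultimately have "degree q > 0" unfolding q_def by (simp add: degree_add_eq_left)
  then obtain x where "poly q x = 0" using assms unfolding alg_closed_def by blast
  moreover have "poly (\<Prod>a\<in>UNIV. [:- a, 1:]) x = 0" using fin by (simp add: poly_prod)
  ultimately show False unfolding q_def by simp
qed

lemma poly_eval_hom: "comm_ring_hom (\<lambda>p. poly p x)"
  by unfold_locales (simp_all add: poly_mult)

text \<open>
  A \<open>\<int>\<^sup>2\<close>-action by operators commuting with a family \<open>G\<close> of linear maps for which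
  Schur's lemma holds, as the action of a central lattice in an irreducible representation.\<close>

locale central_Z2_action = vector_space +
  fixes G :: "('b \<Rightarrow> 'b) set" and Q :: "int \<Rightarrow> int \<Rightarrow> 'b \<Rightarrow> 'b"
  assumes linear_G: "g \<in> G \<Longrightarrow> Vector_Spaces.linear (*s) (*s) g"
    and schur: "\<And>C. Vector_Spaces.linear (*s) (*s) C \<Longrightarrow> (\<And>g. g \<in> G \<Longrightarrow> C \<circ> g = g \<circ> C)
      \<Longrightarrow> C = (\<lambda>_. 0) \<or> bij C"
    and linear_Q: "Vector_Spaces.linear (*s) (*s) (Q a b)"
    and Q_commute: "g \<in> G \<Longrightarrow> Q a b \<circ> g = g \<circ> Q a b"
    and Q_add: "Q (a + a') (b + b') = Q a b \<circ> Q a' b'"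
    and Q_0: "Q 0 0 = id"
begin

abbreviation "X \<equiv> Q 1 0"
abbreviation "X' \<equiv> Q (- 1) 0"
abbreviation "Y \<equiv> Q 0 1"
abbreviation "Y' \<equiv> Q 0 (- 1)"

lemma Q_additive: "Q a b (x + y) = Q a b x + Q a b y"
  and Q_scale: "Q a b (c *s x) = c *s Q a b x"
  using linear_Q[of a b] by (simp_all add: Vector_Spaces.linear_iff)

lemma Q_zero: "Q a b 0 = 0"
  using Q_additive[of a b 0 0] by simp

lemma Q_Q: "Q a b (Q a' b' v) = Q (a + a') (b + b') v"
  by (simp add: Q_add)

lemma X_X': "X (X' v) = v" and X'_X: "X' (X v) = v" and Y_Y': "Y (Y' v) = v" and Y'_Y: "Y' (Y v) = v"
  and X_Y: "X (Y v) = Y (X v)"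
  by (simp_all add: Q_Q Q_0)

lemma Q_induct:
  assumes "Pr id" "Pr X" "Pr X'" "Pr Y" "Pr Y'" and comp: "\<And>f g. Pr f \<Longrightarrow> Pr g \<Longrightarrow> Pr (f \<circ> g)"
  shows "Pr (Q a b)"
proof -
  have "Pr (Q a 0)" for a
  proof (induction a rule: int_induct[where k = 0])
    case (step1 i)
    have "Q (i + 1) 0 = X \<circ> Q i 0" by (metis Q_add add.commute add_0)
    then show ?case using comp[OF \<open>Pr X\<close> step1.IH] by (simp only:)
  next
    case (step2 i)
    have "Q (i - 1) 0 = X' \<circ> Q i 0" by (metis Q_add add_0 uminus_add_conv_diff)
    then show ?case using comp[OF \<open>Pr X'\<close> step2.IH] by (simp only:)
  qed (simp only: Q_0 \<open>Pr id\<close>)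
  moreover have "Pr (Q 0 b)" for b
  proof (induction b rule: int_induct[where k = 0])
    case (step1 i)
    have "Q 0 (i + 1) = Y \<circ> Q 0 i" by (metis Q_add add.commute add_0)
    then show ?case using comp[OF \<open>Pr Y\<close> step1.IH] by (simp only:)
  next
    case (step2 i)
    have "Q 0 (i - 1) = Y' \<circ> Q 0 i" by (metis Q_add add_0 uminus_add_conv_diff)
    then show ?case using comp[OF \<open>Pr Y'\<close> step2.IH] by (simp only:)
  qed (simp only: Q_0 \<open>Pr id\<close>)
  ultimately show ?thesis using comp Q_add[of a 0 0 b] by (metis add_0 add.right_neutral)
qed

lemma invariant_subspace_UNIV:
  assumes gen: "span (\<Union>a b. Q a b ` U) = UNIV" and S: "subspace S" "U \<subseteq> S"
    and closed: "\<And>v. v \<in> S \<Longrightarrow> X v \<in> S \<and> X' v \<in> S \<and> Y v \<in> S \<and> Y' v \<in> S"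
  shows "S = UNIV"
proof -
  have "\<forall>v\<in>S. Q a b v \<in> S" for a b
    by (rule Q_induct[where Pr = "\<lambda>T. \<forall>v\<in>S. T v \<in> S"]) (use closed in auto)
  then have "(\<Union>a b. Q a b ` U) \<subseteq> S" using S(2) by blast
  then have "span (\<Union>a b. Q a b ` U) \<subseteq> S" using S(1) by (rule span_minimal)
  then show ?thesis using gen by blast
qed

abbreviation "act1 \<equiv> poly_act (*s) X"
abbreviation "act2 \<equiv> poly_act act1 Y"

sublocale X_endo: module_endo "(*s)" X
  by (intro module_endo.intro module_endo_axioms.intro)
    (simp_all add: module_iff_vector_space vector_space_axioms Q_additive Q_scale)

lemma act1_commute:
  assumes "\<And>x y. T (x + y) = T x + T y" "\<And>c x. T (c *s x) = c *s T x" "\<And>x. T (X x) = X (T x)"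
  shows "T (act1 q v) = act1 q (T v)"
  by (rule X_endo.poly_act_commute[OF assms])

sublocale Y_endo: module_endo act1 Y
  by (intro module_endo.intro module_endo_axioms.intro X_endo.module_poly_act)
    (simp_all add: Q_additive act1_commute Q_scale X_Y)

sublocale act2: Modules.module act2
  by (rule Y_endo.module_poly_act)

lemma act1_monic_linear: "act1 [:a, 1:] v = a *s v + X v"
  by (simp add: X_endo.poly_act_pCons Q_zero)

lemma act2_commute:
  assumes "\<And>x y. T (x + y) = T x + T y" "\<And>c x. T (c *s x) = c *s T x"
    and "\<And>x. T (X x) = X (T x)" "\<And>x. T (Y x) = Y (T x)"
  shows "T (act2 P v) = act2 P (T v)"
  by (rule Y_endo.poly_act_commute[OF assms(1)]) (simp_all add: act1_commute assms)

lemma act2_zero_or_bij: "act2 P = (\<lambda>_. 0) \<or> bij (act2 P)"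
proof (rule schur)
  show "Vector_Spaces.linear (*s) (*s) (act2 P)"
    unfolding Vector_Spaces.linear_iff
    by (simp add: vector_space_axioms act2.scale_right_distrib act2_commute scale_right_distrib
        scale_left_commute Q_scale)
  fix g assume "g \<in> G"
  then have "g (x + y) = g x + g y" "g (c *s x) = c *s g x" for x y c
    using linear_G by (simp_all add: Vector_Spaces.linear_iff)
  moreover have "g (Q a b x) = Q a b (g x)" for a b x
    using Q_commute[OF \<open>g \<in> G\<close>] by (metis comp_apply)
  ultimately show "act2 P \<circ> g = g \<circ> act2 P" by (simp add: fun_eq_iff act2_commute)
qed

lemma act1_zero_or_bij: "act1 q = (\<lambda>_. 0) \<or> bij (act1 q)"
proof -
  have "act2 [:q:] = act1 q" by (simp add: fun_eq_iff Y_endo.poly_act_const)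
  then show ?thesis using act2_zero_or_bij[of "[:q:]"] by simp
qed

lemma subspace_if_act1_subspace:
  assumes "module.subspace act1 S" shows "subspace S"
  using assms Y_endo.subspace_0 Y_endo.subspace_add Y_endo.subspace_scale[of S _ "[:_:]"]
  by (intro subspaceI) (simp_all add: X_endo.poly_act_const)

lemma subspace_if_act2_subspace:
  assumes "module.subspace act2 S" shows "subspace S"
  using assms act2.subspace_0 act2.subspace_add act2.subspace_scale[of S _ "[:[:_:]:]"]
  by (intro subspaceI) (simp_all add: X_endo.poly_act_const Y_endo.poly_act_const)

lemma X'_act1: "X' (act1 q v) = act1 q (X' v)"
  by (rule act1_commute) (simp_all add: Q_additive Q_scale Q_Q)

lemma X'_act2: "X' (act2 P v) = act2 P (X' v)" and Y'_act2: "Y' (act2 P v) = act2 P (Y' v)"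
  by (rule act2_commute; simp add: Q_additive Q_scale Q_Q add.commute)+

lemma loc_span_XY_UNIV:
  assumes gen: "span (\<Union>a b. Q a b ` U) = UNIV"
  shows "loc_span act2 ([:[:0, 1:]:] * [:0, 1:]) U = UNIV"
proof (rule invariant_subspace_UNIV[OF gen subspace_if_act2_subspace[OF act2.subspace_loc_span]])
  show "U \<subseteq> loc_span act2 ([:[:0, 1:]:] * [:0, 1:]) U"
    using act2.span_subset_loc_span act2.span_superset by blast
  have x: "act2 [:[:0, 1:]:] v = X v" and y: "act2 [:0, 1:] v = Y v" for v
    by (simp_all add: Y_endo.poly_act_const Y_endo.poly_act_X X_endo.poly_act_X)
  fix v assume v: "v \<in> loc_span act2 ([:[:0, 1:]:] * [:0, 1:]) U"
  have "X' v \<in> loc_span act2 ([:[:0, 1:]:] * [:0, 1:]) U"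
    by (rule act2.loc_span_closed_inverse[where x = "[:[:0, 1:]:]", OF Q_additive X'_act2 _ _ v])
      (simp add: x X_X', rule dvd_triv_left)
  moreover have "Y' v \<in> loc_span act2 ([:[:0, 1:]:] * [:0, 1:]) U"
    by (rule act2.loc_span_closed_inverse[where x = "[:0, 1:]", OF Q_additive Y'_act2 _ _ v])
      (simp add: y Y_Y', rule dvd_triv_right)
  ultimately show "X v \<in> loc_span act2 ([:[:0, 1:]:] * [:0, 1:]) U \<and>
      X' v \<in> loc_span act2 ([:[:0, 1:]:] * [:0, 1:]) U \<and>
      Y v \<in> loc_span act2 ([:[:0, 1:]:] * [:0, 1:]) U \<and> Y' v \<in> loc_span act2 ([:[:0, 1:]:] * [:0, 1:]) U"
    using act2.subspace_scale[OF act2.subspace_loc_span v, of "[:[:0, 1:]:]"]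
      act2.subspace_scale[OF act2.subspace_loc_span v, of "[:0, 1:]"]
    by (simp add: x y)
qed

text \<open>
  If \<open>Y - 1\<close> is invertible, the determinant trick modulo \<open>Y - 1\<close> gives an annihilator \<open>d\<close>
  with \<open>d(X, 1) = X\<^sup>m \<noteq> 0\<close>.\<close>

lemma Y_annihilated:
  assumes "finite U" and gen: "span (\<Union>a b. Q a b ` U) = UNIV"
  shows "\<exists>P. P \<noteq> 0 \<and> (\<forall>v. act2 P v = 0)"
proof -
  define \<pi> :: "'a poly poly" where "\<pi> = [:- 1, 1:]"
  consider "act2 \<pi> = (\<lambda>_. 0)" | "bij (act2 \<pi>)" using act2_zero_or_bij by blast
  then show ?thesis
  proof cases
    case 1
    then show ?thesis unfolding \<pi>_def by (metis pCons_eq_0_iff one_neq_zero)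
  next
    case 2
    have "act2 ([:[:0, 1:]:] * [:0, 1:]) v = X (Y v)" for v
      by (simp only: Y_endo.poly_act_mult) (simp add: Y_endo.poly_act_const Y_endo.poly_act_X X_endo.poly_act_X)
    then have "act2 ([:[:0, 1:]:] * [:0, 1:]) v = 0 \<Longrightarrow> v = 0" for v
      using Y'_Y[of v] X'_X[of "Y v"] by (simp add: Q_zero)
    moreover have "surj (act2 \<pi>)" using 2 by (rule bij_is_surj)
    moreover have "poly \<pi> 1 = 0" by (simp add: \<pi>_def)
    ultimately obtain d m where d: "\<forall>v. act2 d v = 0" and "poly d 1 = poly ([:[:0, 1:]:] * [:0, 1:]) 1 ^ m"
      using act2.annihilator_congruent_to_power[OF \<open>finite U\<close> loc_span_XY_UNIV[OF gen] _ _ poly_eval_hom]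
      by blast
    then have "d \<noteq> 0" by auto
    then show ?thesis using d by blast
  qed
qed

text \<open>
  The localising element \<open>X c\<^sub>0 c\<^sub>D\<close>, with \<open>c\<^sub>0\<close> and \<open>c\<^sub>D\<close> the constant and leading coefficient
  of \<open>P\<close>, is what \<open>X\<^sup>-\<^sup>1\<close>, \<open>Y\<close> and \<open>Y\<^sup>-\<^sup>1\<close> need to preserve the span of the \<open>Y\<^sup>j u\<close>, \<open>j < degree P\<close>.\<close>

lemma loc_span_Y_orbit_UNIV:
  assumes gen: "span (\<Union>a b. Q a b ` U) = UNIV"
    and ann: "\<And>v. act2 P v = 0" and "degree P \<noteq> 0"
  shows "loc_span act1 ([:0, 1:] * coeff P 0 * lead_coeff P) (orbit_upto Y U (degree P)) = UNIV"
    (is "loc_span act1 ?S ?W = UNIV")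
proof (rule invariant_subspace_UNIV[OF gen subspace_if_act1_subspace[OF Y_endo.subspace_loc_span]])
  have "U \<subseteq> ?W" by (rule subset_orbit_upto) fact
  also have "?W \<subseteq> loc_span act1 ?S ?W"
    using Y_endo.span_superset Y_endo.span_subset_loc_span by (rule order_trans)
  finally show "U \<subseteq> loc_span act1 ?S ?W" .
  have dvd: "[:0, 1:] dvd ?S" "coeff P 0 dvd ?S" "lead_coeff P dvd ?S"
    by (simp_all only: dvd_triv_left dvd_triv_right dvd_mult dvd_mult2)
  fix v assume v: "v \<in> loc_span act1 ?S ?W"
  have "X v \<in> loc_span act1 ?S ?W"
    using Y_endo.subspace_scale[OF Y_endo.subspace_loc_span v, of "[:0, 1:]"] by (simp add: X_endo.poly_act_X)
  moreover have "X' v \<in> loc_span act1 ?S ?W"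
    by (rule Y_endo.loc_span_closed_inverse[where x = "[:0, 1:]", OF Q_additive X'_act1 _ _ v])
      (simp add: X_endo.poly_act_X X_X', rule dvd(1))
  moreover have "Y v \<in> loc_span act1 ?S ?W" by (rule Y_endo.loc_span_closed_Z[OF ann dvd(3) v])
  moreover have "Y' v \<in> loc_span act1 ?S ?W" by (rule Y_endo.loc_span_closed_Z_inverse[OF ann dvd(2) Y_Y' Y'_Y v])
  ultimately show "X v \<in> loc_span act1 ?S ?W \<and> X' v \<in> loc_span act1 ?S ?W \<and>
      Y v \<in> loc_span act1 ?S ?W \<and> Y' v \<in> loc_span act1 ?S ?W" by blast
qed

lemma eq_0_if_act1_X_mult_eq_0:
  assumes p: "inj (act1 p)" and q: "inj (act1 q)" and "act1 ([:0, 1:] * p * q) v = 0"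
  shows "v = 0"
proof -
  have "X (act1 p (act1 q v)) = 0"
    using assms(3) by (simp only: X_endo.poly_act_mult X_endo.poly_act_X)
  then have "act1 p (act1 q v) = 0" by (metis X'_X Q_zero)
  then have "act1 q v = 0" by (metis injD p Y_endo.scale_zero_right)
  then show "v = 0" by (metis injD q Y_endo.scale_zero_right)
qed

text \<open>
  Otherwise every non-zero element of \<open>k[X]\<close> acts invertibly; the determinant trick modulo
  \<open>X - c\<close>, for some \<open>c\<close> avoiding the finitely many roots of the localising element, then
  produces a non-zero annihilator in \<open>k[X]\<close> after all.\<close>

lemma X_annihilated:
  assumes "finite U" and gen: "span (\<Union>a b. Q a b ` U) = UNIV" and alg: "alg_closed TYPE('a)"
  shows "\<exists>q. q \<noteq> 0 \<and> (\<forall>v. act1 q v = 0)"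
proof (rule ccontr)
  assume none: "\<not> ?thesis"
  then have bij1: "bij (act1 q)" if "q \<noteq> 0" for q
    using act1_zero_or_bij[of q] that by auto
  have "Y v = 0 \<Longrightarrow> v = 0" for v using Y'_Y[of v] by (simp add: Q_zero)
  moreover obtain P0 where "P0 \<noteq> 0" "\<And>v. act2 P0 v = 0" using Y_annihilated[OF assms(1,2)] by blast
  ultimately obtain P where P: "P \<noteq> 0" "coeff P 0 \<noteq> 0" and ann: "\<And>v. act2 P v = 0"
    using Y_endo.exists_annihilator_coeff_0_nonzero by blast
  have "degree P \<noteq> 0"
  proof
    assume "degree P = 0"
    then have "act2 [:coeff P 0:] v = 0" for v using ann[of v] degree_0_id[of P] by simp
    then have "act1 (coeff P 0) v = 0" for v by (simp add: Y_endo.poly_act_const)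
    then show False using none P(2) by blast
  qed
  define S where "S = [:0, 1:] * coeff P 0 * lead_coeff P"
  have "inj (act1 (coeff P 0))" "inj (act1 (lead_coeff P))"
    using bij1 P by (simp_all add: bij_is_inj)
  then have S_inj: "act1 S v = 0 \<Longrightarrow> v = 0" for v
    unfolding S_def by (rule eq_0_if_act1_X_mult_eq_0)
  have "S \<noteq> 0" using P by (simp add: S_def)
  then have "finite {c. poly S c = 0}" by (rule poly_roots_finite)
  then obtain c where c: "c \<notin> {c. poly S c = 0}"
    using ex_new_if_finite[OF alg_closed_infinite[OF alg]] by blast
  have "loc_span act1 S (orbit_upto Y U (degree P)) = UNIV"
    unfolding S_def by (rule loc_span_Y_orbit_UNIV[OF gen ann \<open>degree P \<noteq> 0\<close>])
  moreover have "surj (act1 [:- c, 1:])" using bij1[of "[:- c, 1:]"] by (simp add: bij_is_surj)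
  moreover have "poly [:- c, 1:] c = 0" by simp
  ultimately obtain d m where d: "\<forall>v. act1 d v = 0" and "poly d c = poly S c ^ m"
    using Y_endo.annihilator_congruent_to_power[OF finite_orbit_upto[OF \<open>finite U\<close>] _ S_inj _ poly_eval_hom]
    by blast
  then have "d \<noteq> 0" using c by auto
  then show False using none d by blast
qed

lemma X_scalar:
  assumes "finite U" and "span (\<Union>a b. Q a b ` U) = UNIV" and alg: "alg_closed TYPE('a)"
  shows "\<exists>c. X = (*s) c"
proof (cases "\<exists>v::'b. v \<noteq> 0")
  case False
  then show ?thesis by (intro exI[of _ 0]) (auto simp: fun_eq_iff)
next
  case True
  then obtain v :: 'b where "v \<noteq> 0" by blast
  obtain q where "q \<noteq> 0" "act1 q v = 0" using X_annihilated[OF assms] by blast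
  then obtain c w where "w \<noteq> 0" "X w = c *s w"
    using eigenvector_from_annihilating_poly[OF X_endo.module_endo_axioms alg] \<open>v \<noteq> 0\<close> by blast
  then have "act1 [:- c, 1:] w = 0" by (simp add: act1_monic_linear scale_minus_left)
  moreover have "act1 [:- c, 1:] 0 = 0" by (simp add: act1_monic_linear Q_zero)
  ultimately have "\<not> inj (act1 [:- c, 1:])" using \<open>w \<noteq> 0\<close> by (metis injD)
  then have "act1 [:- c, 1:] u = 0" for u using act1_zero_or_bij bij_is_inj by metis
  then have "X u = c *s u" for u by (simp add: act1_monic_linear scale_minus_left add_eq_0_iff)
  then show ?thesis by blast
qed

lemma scalar_inverse:
  fixes T T' :: "'b \<Rightarrow> 'b"
  assumes "T \<circ> T' = id" and "T = (*s) c"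
  shows "\<exists>c'. T' = (*s) c'"
proof (cases "c = 0")
  case True
  then have "v = 0" for v :: 'b using fun_cong[OF assms(1), of v] assms(2) by simp
  then show ?thesis by (intro exI[of _ 0]) (auto simp: fun_eq_iff)
next
  case False
  have "T' v = inverse c *s v" for v
    using arg_cong[OF fun_cong[OF assms(1), of v], of "(*s) (inverse c)"] assms(2) False by simp
  then show ?thesis by blast
qed

end

theorem (in central_Z2_action) Q_scalar:
  assumes alg: "alg_closed TYPE('a)" and "finite U" and gen: "span (\<Union>a b. Q a b ` U) = UNIV"
  shows "\<exists>c. Q a b = (*s) c"
proof -
  interpret swapped: central_Z2_action scale G "\<lambda>a b. Q b a"
  proof (intro central_Z2_action.intro central_Z2_action_axioms.intro vector_space_axioms)
    show "Q (b + b') (a + a') = Q b a \<circ> Q b' a'" for a a' b b' by (rule Q_add)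
  qed (simp_all add: linear_G schur linear_Q Q_commute Q_0)
  have "(\<Union>a b. Q b a ` U) = (\<Union>a b. Q a b ` U)" by blast
  then have Y: "\<exists>c. Y = (*s) c" using swapped.X_scalar[OF \<open>finite U\<close> _ alg] gen by simp
  have X: "\<exists>c. X = (*s) c" by (rule X_scalar[OF \<open>finite U\<close> gen alg])
  have "X \<circ> X' = id" "Y \<circ> Y' = id" by (simp_all add: fun_eq_iff X_X' Y_Y')
  then have X': "\<exists>c. X' = (*s) c" and Y': "\<exists>c. Y' = (*s) c" using X Y scalar_inverse by blast+
  show ?thesis
  proof (rule Q_induct[where Pr = "\<lambda>T. \<exists>c. T = (*s) c"])
    have "id = (*s) 1" by (simp add: fun_eq_iff)
    then show "\<exists>c. id = (*s) c" by blast
    show "\<exists>c. f \<circ> g = (*s) c" if "\<exists>c. f = (*s) c" "\<exists>c. g = (*s) c" for f g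
      using that by (auto simp: fun_eq_iff)
  qed (fact X X' Y Y')+
qed

corollary (in central_Z2_action) span_eq_UNIV:
  assumes "alg_closed TYPE('a)" and "finite U" and gen: "span (\<Union>a b. Q a b ` U) = UNIV"
  shows "span U = UNIV"
proof -
  have "Q a b u \<in> span U" if "u \<in> U" for a b u
    using Q_scalar[OF assms] that by (metis span_base span_scale)
  then have "span (\<Union>a b. Q a b ` U) \<subseteq> span U" by (intro span_minimal) auto
  then show ?thesis using gen by auto
qed

section \<open>The multiplicative group of the \<open>p\<close>-adic numbers\<close>

locale odd_prime =
  fixes p :: nat
  assumes prime: "prime p" and odd: "odd p"
begin

abbreviation "P \<equiv> int p"

lemma P_gt_1: "P > 1"
  using prime prime_gt_1_nat by auto

lemma prime_P: "prime P"
  using prime by simp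

lemma P_power_pos: "P ^ n > 0"
  using P_gt_1 by simp

lemma mod_P_power_bounds: "0 \<le> a mod P ^ n" "a mod P ^ n < P ^ n"
  using P_power_pos[of n] by simp_all

definition zp_one :: zp where "zp_one = (\<lambda>n. 1 mod P ^ n)"

definition zp_of_int :: "int \<Rightarrow> zp" where "zp_of_int c = (\<lambda>n. c mod P ^ n)"

lemma zp_carrier_simps:
  assumes "x \<in> zp_carrier P"
  shows "0 \<le> x n" "x n < P ^ n" "x n = x (Suc n) mod P ^ n" "x n mod P ^ n = x n"
proof -
  show "0 \<le> x n" "x n < P ^ n" "x n = x (Suc n) mod P ^ n"
    using assms unfolding zp_carrier_def by blast+
  then show "x n mod P ^ n = x n" by simp
qed

lemma zp_carrier_mod:
  assumes "x \<in> zp_carrier P" "n \<le> m"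
  shows "x n = x m mod P ^ n"
  using assms(2)
proof (induction m)
  case (Suc m)
  show ?case
  proof (cases "n = Suc m")
    case True
    then show ?thesis using zp_carrier_simps(4)[OF assms(1), of n] by simp
  next
    case False
    then have "n \<le> m" using Suc by simp
    then have "x n = x (Suc m) mod P ^ m mod P ^ n"
      using Suc.IH zp_carrier_simps(3)[OF assms(1), of m] by simp
    also have "\<dots> = x (Suc m) mod P ^ n"
      using \<open>n \<le> m\<close> by (intro mod_mod_cancel le_imp_power_dvd)
    finally show ?thesis .
  qed
qed (use zp_carrier_simps(4)[OF assms(1), of 0] in simp)

lemma zp_units_carrier: "x \<in> zp_units P \<Longrightarrow> x \<in> zp_carrier P"
  unfolding zp_units_def by simp

lemma zp_units_not_dvd:
  assumes "x \<in> zp_units P" "1 \<le> j"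
  shows "\<not> P dvd x j"
proof
  assume "P dvd x j"
  then have "x 1 = 0"
    using zp_carrier_mod[OF zp_units_carrier[OF assms(1)] assms(2)] by simp
  then show False using assms(1) unfolding zp_units_def by simp
qed

lemma zp_units_coprime:
  assumes "x \<in> zp_units P"
  shows "coprime (x j) (P ^ j)"
proof (cases "j = 0")
  case False
  then have "\<not> P dvd x j" using zp_units_not_dvd[OF assms] by simp
  then show ?thesis using prime_P by (simp add: prime_imp_coprime coprime_commute)
qed simp

lemma zp_mul_carrier:
  assumes "x \<in> zp_carrier P" "y \<in> zp_carrier P"
  shows "zp_mul P x y \<in> zp_carrier P"
  unfolding zp_carrier_def zp_mul_def
proof (intro CollectI allI conjI)
  fix n
  show "0 \<le> x n * y n mod P ^ n" "x n * y n mod P ^ n < P ^ n" by (simp_all add: mod_P_power_bounds)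
  have "x (Suc n) * y (Suc n) mod P ^ Suc n mod P ^ n = x (Suc n) * y (Suc n) mod P ^ n"
    by (intro mod_mod_cancel le_imp_power_dvd) simp
  also have "\<dots> = x n * y n mod P ^ n"
    using zp_carrier_simps(3)[OF assms(1), of n] zp_carrier_simps(3)[OF assms(2), of n]
    by (simp add: mod_mult_eq)
  finally show "x n * y n mod P ^ n = x (Suc n) * y (Suc n) mod P ^ Suc n mod P ^ n" by simp
qed

lemma zp_mul_units:
  assumes "x \<in> zp_units P" "y \<in> zp_units P"
  shows "zp_mul P x y \<in> zp_units P"
proof -
  have "\<not> P dvd x 1 * y 1"
    using zp_units_not_dvd[OF assms(1)] zp_units_not_dvd[OF assms(2)] prime_P
    by (simp add: prime_dvd_mult_iff)
  then have "zp_mul P x y 1 \<noteq> 0" unfolding zp_mul_def by (simp add: dvd_eq_mod_eq_0)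
  then show ?thesis using assms zp_mul_carrier unfolding zp_units_def by auto
qed

lemma zp_mul_comm: "zp_mul P x y = zp_mul P y x"
  unfolding zp_mul_def by (simp add: mult.commute)

lemma zp_mul_assoc: "zp_mul P (zp_mul P x y) z = zp_mul P x (zp_mul P y z)"
  unfolding zp_mul_def by (simp add: mod_mult_left_eq mod_mult_right_eq mult.assoc)

lemma zp_of_int_carrier: "zp_of_int c \<in> zp_carrier P"
  unfolding zp_carrier_def zp_of_int_def
proof (intro CollectI allI conjI)
  fix n
  show "0 \<le> c mod P ^ n" "c mod P ^ n < P ^ n" by (simp_all add: mod_P_power_bounds)
  show "c mod P ^ n = c mod P ^ Suc n mod P ^ n"
    by (intro mod_mod_cancel[symmetric] le_imp_power_dvd) simp
qed

lemma zp_one_units: "zp_one \<in> zp_units P"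
  using zp_of_int_carrier[of 1] P_gt_1 unfolding zp_units_def zp_one_def zp_of_int_def by simp

lemma zp_mul_one: "x \<in> zp_carrier P \<Longrightarrow> zp_mul P zp_one x = x"
  unfolding zp_mul_def zp_one_def using zp_carrier_simps(4) by (simp add: mod_mult_left_eq fun_eq_iff)

lemma zp_inv_unique:
  assumes "x \<in> zp_units P"
  shows "\<exists>!y. 0 \<le> y \<and> y < P ^ j \<and> (x j * y) mod P ^ j = 1 mod P ^ j"
proof -
  obtain y where y: "[x j * y = 1] (mod P ^ j)"
    using cong_solve_coprime_int[OF zp_units_coprime[OF assms]] by blast
  show ?thesis
  proof (rule ex1I[of _ "y mod P ^ j"])
    show "0 \<le> y mod P ^ j \<and> y mod P ^ j < P ^ j \<and> (x j * (y mod P ^ j)) mod P ^ j = 1 mod P ^ j"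
      using y mod_P_power_bounds by (simp add: cong_def mod_mult_right_eq)
    fix z assume z: "0 \<le> z \<and> z < P ^ j \<and> (x j * z) mod P ^ j = 1 mod P ^ j"
    then have "[x j * z = x j * y] (mod P ^ j)" using y by (simp add: cong_def)
    then have "[z = y] (mod P ^ j)" using zp_units_coprime[OF assms] by (metis cong_mult_lcancel)
    then show "z = y mod P ^ j" using z by (simp add: cong_def)
  qed
qed

lemma zp_inv_spec:
  assumes "x \<in> zp_units P"
  shows "0 \<le> zp_inv P x j" "zp_inv P x j < P ^ j" "(x j * zp_inv P x j) mod P ^ j = 1 mod P ^ j"
  using theI'[OF zp_inv_unique[OF assms, of j]] unfolding zp_inv_def by auto

lemma zp_inv_eqI:
  assumes "x \<in> zp_units P" "0 \<le> y" "y < P ^ j" "(x j * y) mod P ^ j = 1 mod P ^ j"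
  shows "zp_inv P x j = y"
  using zp_inv_unique[OF assms(1), of j] zp_inv_spec[OF assms(1), of j] assms(2-4) by blast

lemma zp_inv_units:
  assumes x: "x \<in> zp_units P"
  shows "zp_inv P x \<in> zp_units P"
proof -
  have "zp_inv P x \<in> zp_carrier P" unfolding zp_carrier_def
  proof (intro CollectI allI conjI)
    fix j
    show "0 \<le> zp_inv P x j" "zp_inv P x j < P ^ j" by (rule zp_inv_spec[OF x])+
    have "x j * (zp_inv P x (Suc j) mod P ^ j) mod P ^ j = x (Suc j) * zp_inv P x (Suc j) mod P ^ j"
      using zp_carrier_simps(3)[OF zp_units_carrier[OF x], of j] by (simp add: mod_mult_eq)
    also have "\<dots> = x (Suc j) * zp_inv P x (Suc j) mod P ^ Suc j mod P ^ j"
      by (intro mod_mod_cancel[symmetric] le_imp_power_dvd) simp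
    also have "\<dots> = 1 mod P ^ Suc j mod P ^ j" using zp_inv_spec(3)[OF x, of "Suc j"] by simp
    also have "\<dots> = 1 mod P ^ j" by (intro mod_mod_cancel le_imp_power_dvd) simp
    finally show "zp_inv P x j = zp_inv P x (Suc j) mod P ^ j"
      using mod_P_power_bounds by (intro zp_inv_eqI[OF x]) simp_all
  qed
  moreover have "zp_inv P x 1 \<noteq> 0" using zp_inv_spec(3)[OF x, of 1] P_gt_1 by auto
  ultimately show ?thesis unfolding zp_units_def by simp
qed

lemma zp_mul_inv_cancel:
  assumes "x \<in> zp_units P" and "u \<in> zp_carrier P"
  shows "zp_mul P x (zp_mul P (zp_inv P x) u) = u"
proof
  fix j
  have "zp_mul P x (zp_mul P (zp_inv P x) u) j = ((x j * zp_inv P x j) mod P ^ j * u j) mod P ^ j"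
    unfolding zp_mul_def by (simp add: mod_mult_right_eq mod_mult_left_eq mult.assoc)
  also have "\<dots> = u j"
    using zp_inv_spec(3)[OF assms(1), of j] zp_carrier_simps(4)[OF assms(2), of j] by (simp add: mod_mult_left_eq)
  finally show "zp_mul P x (zp_mul P (zp_inv P x) u) j = u j" .
qed


lemma zp_of_int_units:
  assumes "u \<in> zp_units P" and "1 \<le> n"
  shows "zp_of_int (u n) \<in> zp_units P"
  using zp_of_int_carrier zp_carrier_mod[OF zp_units_carrier[OF assms(1)] assms(2)] assms(1)
  unfolding zp_units_def zp_of_int_def by simp

lemma qone_eq: "qone P = (0, zp_one)"
  unfolding qone_def zp_one_def ..

lemma qmul_carrier: "x \<in> qpx_carrier P \<Longrightarrow> y \<in> qpx_carrier P \<Longrightarrow> qmul P x y \<in> qpx_carrier P"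
  unfolding qpx_carrier_def qmul_def by (auto intro: zp_mul_units)

lemma qinv_carrier: "x \<in> qpx_carrier P \<Longrightarrow> qinv P x \<in> qpx_carrier P"
  unfolding qpx_carrier_def qinv_def by (auto intro: zp_inv_units)

lemma qone_carrier: "qone P \<in> qpx_carrier P"
  unfolding qone_eq qpx_carrier_def using zp_one_units by simp

lemma qminus_one_carrier: "qminus_one P \<in> qpx_carrier P"
proof -
  have "(\<lambda>n. P ^ n - 1) \<in> zp_carrier P" unfolding zp_carrier_def
  proof (intro CollectI allI conjI)
    fix n
    show "0 \<le> P ^ n - 1" using P_power_pos[of n] by linarith
    show "P ^ n - 1 < P ^ n" by simp
    have "P ^ Suc n - 1 = - 1 + P * P ^ n" by simp
    then have "(P ^ Suc n - 1) mod P ^ n = (- 1) mod P ^ n" by (simp only: mod_mult_self1)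
    also have "\<dots> = P ^ n - 1" using P_power_pos by (rule zmod_minus1)
    finally show "P ^ n - 1 = (P ^ Suc n - 1) mod P ^ n" by simp
  qed
  then show ?thesis using P_gt_1 unfolding qminus_one_def qpx_carrier_def zp_units_def by simp
qed

lemma snd_qpx_units: "x \<in> qpx_carrier P \<Longrightarrow> snd x \<in> zp_units P"
  unfolding qpx_carrier_def by (cases x) simp

lemma fst_qmul [simp]: "fst (qmul P x y) = fst x + fst y"
  unfolding qmul_def by simp

lemma fst_qinv [simp]: "fst (qinv P x) = - fst x"
  unfolding qinv_def by simp

lemma omega_qmul: "omega (qmul P x y) = (omega x * omega y) mod P"
  unfolding omega_def qmul_def zp_mul_def by simp

lemma omega_not_dvd: "x \<in> qpx_carrier P \<Longrightarrow> \<not> P dvd omega x"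
  unfolding omega_def using snd_qpx_units zp_units_not_dvd by blast

lemma omega_qinv:
  assumes "x \<in> qpx_carrier P"
  shows "[omega x * omega (qinv P x) = 1] (mod P)"
  using zp_inv_spec(3)[OF snd_qpx_units[OF assms], of 1] unfolding omega_def qinv_def cong_def by simp

lemma qmul_assoc: "qmul P (qmul P x y) z = qmul P x (qmul P y z)"
  unfolding qmul_def by (simp add: zp_mul_assoc add.assoc)

lemma qmul_comm: "qmul P x y = qmul P y x"
  unfolding qmul_def by (simp add: zp_mul_comm add.commute)

lemma QuadRes_omega_qmul:
  assumes "QuadRes P (omega x)" and "QuadRes P (omega y)"
  shows "QuadRes P (omega (qmul P x y))"
proof -
  obtain s t where "[s ^ 2 = omega x] (mod P)" "[t ^ 2 = omega y] (mod P)"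
    using assms unfolding QuadRes_def by blast
  then have "[s ^ 2 * t ^ 2 = omega x * omega y] (mod P)" by (rule cong_mult)
  then have "[(s * t) ^ 2 = omega (qmul P x y)] (mod P)"
    unfolding omega_qmul by (simp add: cong_def power_mult_distrib)
  then show ?thesis unfolding QuadRes_def by blast
qed

lemma QuadRes_omega_qinv:
  assumes x: "x \<in> qpx_carrier P" and "QuadRes P (omega x)"
  shows "QuadRes P (omega (qinv P x))"
proof -
  obtain t where t: "[t ^ 2 = omega x] (mod P)" using assms(2) unfolding QuadRes_def by blast
  define i where "i = omega (qinv P x)"
  have "[i = i * (omega x * i)] (mod P)"
    using cong_mult[OF cong_refl[of i] omega_qinv[OF x]] unfolding i_def by (simp add: cong_sym)
  also have "i * (omega x * i) = omega x * i ^ 2" by (simp add: power2_eq_square)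
  also have "[\<dots> = t ^ 2 * i ^ 2] (mod P)" using cong_mult[OF cong_sym[OF t] cong_refl] .
  finally have "[(t * i) ^ 2 = i] (mod P)" by (simp add: power_mult_distrib cong_sym)
  then show ?thesis unfolding QuadRes_def i_def by blast
qed

lemma QuadRes_omega_cong:
  "[omega x = omega y] (mod P) \<Longrightarrow> QuadRes P (omega y) \<Longrightarrow> QuadRes P (omega x)"
  unfolding QuadRes_def using cong_trans cong_sym by blast

definition qpow_nat :: "qpx \<Rightarrow> nat \<Rightarrow> qpx" where
  "qpow_nat x n = ((qmul P x) ^^ n) (qone P)"

lemma qpow_eq: "qpow P x k = (if 0 \<le> k then qpow_nat x (nat k) else qinv P (qpow_nat x (nat (- k))))"
  unfolding qpow_def qpow_nat_def by simp

lemma qpow_nat_carrier: "x \<in> qpx_carrier P \<Longrightarrow> qpow_nat x n \<in> qpx_carrier P"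
  by (induction n) (simp_all add: qpow_nat_def qone_carrier qmul_carrier)

lemma qpow_carrier: "x \<in> qpx_carrier P \<Longrightarrow> qpow P x k \<in> qpx_carrier P"
  by (simp add: qpow_eq qpow_nat_carrier qinv_carrier)

lemma omega_qpow_nat: "omega (qpow_nat x n) = omega x ^ n mod P"
proof (induction n)
  case 0
  then show ?case using P_gt_1 by (simp add: qpow_nat_def qone_eq zp_one_def omega_def)
next
  case (Suc n)
  then show ?case by (simp add: qpow_nat_def omega_qmul mod_mult_right_eq)
qed

lemma QuadRes_omega_qpow:
  assumes x: "x \<in> qpx_carrier P" and sq: "QuadRes P (omega x) \<or> even k"
  shows "QuadRes P (omega (qpow P x k))"
proof -
  have QuadRes_nat: "QuadRes P (omega (qpow_nat x n))" if "QuadRes P (omega x) \<or> even n" for n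
    using that
  proof
    assume "QuadRes P (omega x)"
    then obtain t where "[t ^ 2 = omega x] (mod P)" unfolding QuadRes_def by blast
    then have "[(t ^ 2) ^ n = omega x ^ n] (mod P)" by (rule cong_pow)
    then have "[(t ^ n) ^ 2 = omega (qpow_nat x n)] (mod P)"
      unfolding omega_qpow_nat by (simp add: cong_def power_mult[symmetric] mult.commute)
    then show ?thesis unfolding QuadRes_def by blast
  next
    assume "even n"
    then obtain m where "n = 2 * m" by blast
    then have "[(omega x ^ m) ^ 2 = omega (qpow_nat x n)] (mod P)"
      unfolding omega_qpow_nat by (simp add: cong_def power_mult[symmetric] mult.commute)
    then show ?thesis unfolding QuadRes_def by blast
  qed
  show ?thesis
  proof (cases "0 \<le> k")
    case True
    then show ?thesis using sq QuadRes_nat[of "nat k"] by (simp add: qpow_eq even_nat_iff)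
  next
    case False
    then show ?thesis using sq QuadRes_nat[of "nat (- k)"]
      by (simp add: qpow_eq even_nat_iff QuadRes_omega_qinv qpow_nat_carrier[OF x])
  qed
qed

text \<open>By Euler's criterion, the Hilbert symbol is trivial as soon as its argument
  \<open>(-1)\<^bsup>v(a)v(b)\<^esup> b\<^bsup>v(a)\<^esup> / a\<^bsup>v(b)\<^esup>\<close> has square residue.\<close>

lemma hilbert_eq_1:
  assumes a: "a \<in> qpx_carrier P" and b: "b \<in> qpx_carrier P"
    and "even (fst a) \<or> even (fst b)"
    and "QuadRes P (omega b) \<or> even (fst a)" and "QuadRes P (omega a) \<or> even (fst b)"
  shows "hilbert P a b = 1"
proof -
  define x where "x = qmul P (qpow P (qminus_one P) (pval a * pval b))
                     (qmul P (qpow P b (pval a)) (qinv P (qpow P a (pval b))))"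
  have "x \<in> qpx_carrier P"
    unfolding x_def by (intro qmul_carrier qinv_carrier qpow_carrier qminus_one_carrier a b)
  then have not_dvd: "\<not> P dvd omega x" by (rule omega_not_dvd)
  have "QuadRes P (omega x)"
    unfolding x_def using assms
    by (intro QuadRes_omega_qmul QuadRes_omega_qinv QuadRes_omega_qpow qpow_carrier qminus_one_carrier)
      (auto simp: pval_def)
  then have "Legendre (omega x) P = 1"
    using not_dvd by (simp add: Legendre_def cong_0_iff)
  moreover have "p > 2" using prime_ge_2_nat[OF prime] odd by (cases "p = 2") auto
  ultimately have "[1 = omega x ^ ((p - 1) div 2)] (mod P)"
    using euler_criterion[OF prime, of "omega x"] by simp
  moreover have "nat ((P - 1) div 2) = (p - 1) div 2" by (simp add: nat_div_distrib of_nat_diff)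
  ultimately show ?thesis
    unfolding hilbert_def x_def[symmetric] Let_def using P_gt_1 by (simp add: cong_def)
qed


section \<open>The metaplectic torus\<close>

definition ppow :: "int \<Rightarrow> qpx" where "ppow e = (e, zp_one)"

lemma ppow_carrier: "ppow e \<in> qpx_carrier P"
  unfolding ppow_def qpx_carrier_def using zp_one_units by simp

lemma fst_ppow [simp]: "fst (ppow e) = e"
  unfolding ppow_def by simp

lemma QuadRes_omega_ppow: "QuadRes P (omega (ppow e))"
  unfolding QuadRes_def ppow_def omega_def zp_one_def by (intro exI[of _ 1]) (simp add: cong_def)

lemma qmul_ppow: "a \<in> qpx_carrier P \<Longrightarrow> qmul P (ppow e) a = (fst a + e, snd a)"
  unfolding ppow_def qmul_def using zp_mul_one snd_qpx_units zp_units_carrier by simp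

lemma qmul_ppow_right: "a \<in> qpx_carrier P \<Longrightarrow> qmul P a (ppow e) = (fst a + e, snd a)"
  using qmul_ppow qmul_comm by metis

lemma qmul_ppow_ppow: "qmul P (ppow a) (ppow b) = ppow (a + b)"
  using qmul_ppow[OF ppow_carrier, of a b] by (simp add: ppow_def add.commute)

lemma omega_conj:
  assumes y: "y \<in> qpx_carrier P"
  shows "[omega (qmul P (qmul P w y) (qinv P y)) = omega w] (mod P)"
proof -
  have "[omega w * (omega y * omega (qinv P y)) = omega w * 1] (mod P)"
    by (rule cong_mult[OF cong_refl omega_qinv[OF y]])
  then show ?thesis by (simp add: omega_qmul cong_def mod_mult_left_eq mult.assoc)
qed

lemma tt_sigma_eq:
  "tt_sigma P (a1, d1) (a2, d2) = hilbert P (qmul P (qmul P d1 d2) (qinv P d1))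
      (qmul P (qmul P (qmul P a1 d1) (qmul P d1 d2)) (qinv P d2))"
  by (simp add: tt_sigma_def Let_def)

lemma tt_sigma_square_right:
  assumes "a1 \<in> qpx_carrier P" "d1 \<in> qpx_carrier P" "a2 \<in> qpx_carrier P" "d2 \<in> qpx_carrier P"
    and "QuadRes P (omega d2)" and "even (fst d2)"
  shows "tt_sigma P (a1, d1) (a2, d2) = 1"
  unfolding tt_sigma_eq
proof (rule hilbert_eq_1)
  let ?A = "qmul P (qmul P d1 d2) (qinv P d1)"
  have "[omega ?A = omega d2] (mod P)" using omega_conj[OF assms(2), of d2] by (simp add: qmul_comm)
  then show "QuadRes P (omega ?A) \<or> even (fst (qmul P (qmul P (qmul P a1 d1) (qmul P d1 d2)) (qinv P d2)))"
    using QuadRes_omega_cong assms(5) by blast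
qed (use assms in \<open>auto intro: qmul_carrier qinv_carrier\<close>)

lemma tt_sigma_ppow_left:
  assumes "even e1" "even e2" "a2 \<in> qpx_carrier P" "d2 \<in> qpx_carrier P"
  shows "tt_sigma P (ppow e1, ppow e2) (a2, d2) = 1"
  unfolding tt_sigma_eq
proof (rule hilbert_eq_1)
  let ?B = "qmul P (qmul P (qmul P (ppow e1) (ppow e2)) (qmul P (ppow e2) d2)) (qinv P d2)"
  have "?B = qmul P (qmul P (ppow (e1 + e2 + e2)) d2) (qinv P d2)"
    by (simp add: qmul_assoc[symmetric] qmul_ppow_ppow)
  then have "[omega ?B = omega (ppow (e1 + e2 + e2))] (mod P)" using omega_conj[OF assms(4)] by simp
  then show "QuadRes P (omega ?B) \<or> even (fst (qmul P (qmul P (ppow e2) d2) (qinv P (ppow e2))))"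
    using QuadRes_omega_cong QuadRes_omega_ppow by blast
qed (use assms in \<open>auto intro: qmul_carrier qinv_carrier ppow_carrier\<close>)

lemma mem_tt_carrier: "((a, d), z) \<in> tt_carrier P \<longleftrightarrow> a \<in> qpx_carrier P \<and> d \<in> qpx_carrier P \<and> z \<in> {1, -1}"
  unfolding tt_carrier_def by simp

lemma tt_mul_eq:
  "tt_mul P ((a1, d1), z1) ((a2, d2), z2) =
    ((qmul P a1 a2, qmul P d1 d2), z1 * z2 * tt_sigma P (a1, d1) (a2, d2))"
  unfolding tt_mul_def by simp

lemma tt_mul_carrier:
  assumes "g \<in> tt_carrier P" "h \<in> tt_carrier P"
  shows "tt_mul P g h \<in> tt_carrier P"
proof -
  obtain a1 d1 z1 a2 d2 z2 where g: "g = ((a1, d1), z1)" and h: "h = ((a2, d2), z2)"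
    by (metis prod.collapse)
  have "tt_sigma P (a1, d1) (a2, d2) \<in> {1, -1}"
    unfolding tt_sigma_eq hilbert_def Let_def by simp
  then show ?thesis using assms unfolding g h tt_mul_eq mem_tt_carrier by (auto intro: qmul_carrier)
qed

definition tt_pdiag :: "int \<Rightarrow> int \<Rightarrow> ttilde" where
  "tt_pdiag e1 e2 = ((ppow e1, ppow e2), 1)"

lemma tt_pdiag_carrier: "tt_pdiag e1 e2 \<in> tt_carrier P"
  unfolding tt_pdiag_def mem_tt_carrier using ppow_carrier by simp

lemma tt_pdiag_0: "tt_pdiag 0 0 = tt_one P"
  unfolding tt_one_def tt_pdiag_def ppow_def qone_eq ..

lemma tt_one_carrier: "tt_one P \<in> tt_carrier P"
  unfolding tt_pdiag_0[symmetric] by (rule tt_pdiag_carrier)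

lemma tt_pdiag_mul:
  assumes "even e1" "even e2" and g: "((a, d), z) \<in> tt_carrier P"
  shows "tt_mul P (tt_pdiag e1 e2) ((a, d), z) = (((fst a + e1, snd a), (fst d + e2, snd d)), z)"
  using g unfolding mem_tt_carrier tt_pdiag_def tt_mul_eq
  by (simp add: tt_sigma_ppow_left[OF assms(1,2)] qmul_ppow)

lemma tt_mul_pdiag:
  assumes "even e1" "even e2" and g: "((a, d), z) \<in> tt_carrier P"
  shows "tt_mul P ((a, d), z) (tt_pdiag e1 e2) = (((fst a + e1, snd a), (fst d + e2, snd d)), z)"
  using g unfolding mem_tt_carrier tt_pdiag_def tt_mul_eq
  by (simp add: tt_sigma_square_right ppow_carrier QuadRes_omega_ppow assms(2) qmul_ppow_right)

lemma tt_pdiag_central: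
  "even e1 \<Longrightarrow> even e2 \<Longrightarrow> g \<in> tt_carrier P \<Longrightarrow> tt_mul P (tt_pdiag e1 e2) g = tt_mul P g (tt_pdiag e1 e2)"
  by (cases g) (auto simp: tt_pdiag_mul tt_mul_pdiag)

lemma tt_pdiag_add:
  assumes "even e1" "even e2"
  shows "tt_mul P (tt_pdiag e1 e2) (tt_pdiag e1' e2') = tt_pdiag (e1 + e1') (e2 + e2')"
  using tt_pdiag_mul[OF assms, of "ppow e1'" "ppow e2'" 1] tt_pdiag_carrier[of e1' e2']
  by (simp add: tt_pdiag_def ppow_def add.commute)


text \<open>A unit \<open>u\<close> of \<open>\<int>\<^sub>p\<close> is its truncation \<open>u mod p\<^sup>n\<close> times a unit congruent to \<open>1\<close> modulo \<open>p\<^sup>n\<close>.\<close>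

definition principal_part :: "zp \<Rightarrow> nat \<Rightarrow> zp" where
  "principal_part u n = zp_mul P (zp_inv P (zp_of_int (u n))) u"

lemma principal_part_units: "u \<in> zp_units P \<Longrightarrow> 1 \<le> n \<Longrightarrow> principal_part u n \<in> zp_units P"
  unfolding principal_part_def by (intro zp_mul_units zp_inv_units zp_of_int_units)

lemma principal_part_congruent:
  assumes u: "u \<in> zp_units P" and n: "1 \<le> n"
  shows "principal_part u n n = 1 mod P ^ n"
proof -
  have "zp_of_int (u n) n = u n"
    unfolding zp_of_int_def using zp_carrier_simps(4)[OF zp_units_carrier[OF u]] .
  then have "principal_part u n n = (zp_of_int (u n) n * zp_inv P (zp_of_int (u n)) n) mod P ^ n"
    unfolding principal_part_def zp_mul_def by (simp add: mult.commute)
  also have "\<dots> = 1 mod P ^ n" by (rule zp_inv_spec(3)[OF zp_of_int_units[OF u n]])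
  finally show ?thesis .
qed

lemma principal_part_1:
  assumes u: "u \<in> zp_units P" and n: "1 \<le> n"
  shows "principal_part u n 1 = 1"
proof -
  have "principal_part u n 1 = principal_part u n n mod P"
    using zp_carrier_mod[OF zp_units_carrier[OF principal_part_units[OF u n]] n] by simp
  also have "\<dots> = 1"
    unfolding principal_part_congruent[OF u n] using n P_gt_1 by (simp add: mod_mod_cancel dvd_power)
  finally show ?thesis .
qed

lemma zp_of_int_mul_principal_part:
  "u \<in> zp_units P \<Longrightarrow> 1 \<le> n \<Longrightarrow> zp_mul P (zp_of_int (u n)) (principal_part u n) = u"
  unfolding principal_part_def by (intro zp_mul_inv_cancel zp_of_int_units zp_units_carrier)

text \<open>Representatives of \<open>T~\<close> modulo \<open>K\<^sub>n\<close> and the central diagonal matrices of even powers of \<open>p\<close>.\<close>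

definition unit_residues :: "nat \<Rightarrow> int set" where
  "unit_residues n = {c \<in> {0..<P ^ n}. \<not> P dvd c}"

definition tt_reps :: "nat \<Rightarrow> ttilde set" where
  "tt_reps n = (\<lambda>(e1, e2, c1, c2, z). (((e1, zp_of_int c1), (e2, zp_of_int c2)), z)) `
      ({0, 1} \<times> {0, 1} \<times> unit_residues n \<times> unit_residues n \<times> {1, -1})"

lemma finite_tt_reps: "finite (tt_reps n)"
proof -
  have "finite (unit_residues n)" unfolding unit_residues_def by (rule finite_subset[of _ "{0..<P ^ n}"]) auto
  then show ?thesis unfolding tt_reps_def by simp
qed

lemma tt_reps_carrier: "tt_reps n \<subseteq> tt_carrier P"
proof -
  have "(e, zp_of_int c) \<in> qpx_carrier P" if "\<not> P dvd c" for e c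
    using that zp_of_int_carrier unfolding qpx_carrier_def zp_units_def zp_of_int_def by auto
  then show ?thesis unfolding tt_reps_def unit_residues_def by (auto simp: mem_tt_carrier)
qed

lemma tt_decompose:
  assumes g: "g \<in> tt_carrier P" and n: "1 \<le> n"
  shows "\<exists>e1 e2. \<exists>h\<in>tt_reps n. \<exists>k\<in>tt_K P n. g = tt_mul P (tt_pdiag (2 * e1) (2 * e2)) (tt_mul P h k)"
proof -
  obtain a d z where g_eq: "g = ((a, d), z)" by (metis prod.collapse)
  have a: "a \<in> qpx_carrier P" and d: "d \<in> qpx_carrier P" and z: "z \<in> {1, -1}"
    using g unfolding g_eq mem_tt_carrier by auto
  have ua: "snd a \<in> zp_units P" and ud: "snd d \<in> zp_units P" using a d by (simp_all add: snd_qpx_units)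
  define h where "h = (((fst a mod 2, zp_of_int (snd a n)), (fst d mod 2, zp_of_int (snd d n))), z)"
  define k where "k = ((((0::int), principal_part (snd a) n), ((0::int), principal_part (snd d) n)), 1 :: int)"
  have "snd a n \<in> unit_residues n" "snd d n \<in> unit_residues n"
    unfolding unit_residues_def
    using zp_carrier_simps(1,2)[OF zp_units_carrier[OF ua]] zp_carrier_simps(1,2)[OF zp_units_carrier[OF ud]]
      zp_units_not_dvd[OF ua n] zp_units_not_dvd[OF ud n] by auto
  moreover have "fst a mod 2 \<in> {0, 1}" "fst d mod 2 \<in> {0, 1}" by (simp_all add: mod2_eq_if)
  ultimately have h: "h \<in> tt_reps n"
    unfolding tt_reps_def h_def using z by (auto intro!: image_eqI[of _ _ "(fst a mod 2, fst d mod 2, snd a n, snd d n, z)"])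
  have k_carrier: "(0, principal_part (snd a) n) \<in> qpx_carrier P" "(0, principal_part (snd d) n) \<in> qpx_carrier P"
    using principal_part_units[OF ua n] principal_part_units[OF ud n] by (simp_all add: qpx_carrier_def)
  then have k: "k \<in> tt_K P n"
    unfolding k_def tt_K_def using principal_part_congruent[OF ua n] principal_part_congruent[OF ud n] by simp
  have h_carrier: "(fst a mod 2, zp_of_int (snd a n)) \<in> qpx_carrier P" "(fst d mod 2, zp_of_int (snd d n)) \<in> qpx_carrier P"
    using zp_of_int_units[OF ua n] zp_of_int_units[OF ud n] by (simp_all add: qpx_carrier_def)
  \<comment> \<open>the cocycle vanishes on \<open>(h, k)\<close> since the lower entry of \<open>k\<close> is a unit congruent to 1\<close>
  have "tt_sigma P ((fst a mod 2, zp_of_int (snd a n)), (fst d mod 2, zp_of_int (snd d n)))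
      ((0, principal_part (snd a) n), (0, principal_part (snd d) n)) = 1"
    using h_carrier k_carrier principal_part_1[OF ud n]
    by (intro tt_sigma_square_right) (simp_all add: omega_def QuadRes_def exI[of _ 1] cong_def)
  then have hk: "tt_mul P h k = (((fst a mod 2, snd a), (fst d mod 2, snd d)), z)"
    unfolding h_def k_def tt_mul_eq using zp_of_int_mul_principal_part[OF ua n] zp_of_int_mul_principal_part[OF ud n]
    by (simp add: qmul_def)
  have "(((fst a mod 2, snd a), (fst d mod 2, snd d)), z) \<in> tt_carrier P"
    using a d z ua ud unfolding mem_tt_carrier by (simp add: qpx_carrier_def)
  then have "tt_mul P (tt_pdiag (2 * (fst a div 2)) (2 * (fst d div 2))) (tt_mul P h k) = g"
    unfolding hk g_eq by (simp add: tt_pdiag_mul)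
  then show ?thesis using h k by blast
qed

lemma tt_K_mono:
  assumes "n \<le> m" shows "tt_K P m \<subseteq> tt_K P n"
proof
  fix t assume "t \<in> tt_K P m"
  then obtain a d where t: "t = ((a, d), 1)" "a \<in> qpx_carrier P" "d \<in> qpx_carrier P"
    "fst a = 0" "fst d = 0" "snd a m = 1 mod P ^ m" "snd d m = 1 mod P ^ m"
    unfolding tt_K_def by blast
  have "(1::int) mod P ^ m mod P ^ n = 1 mod P ^ n"
    using assms by (intro mod_mod_cancel le_imp_power_dvd)
  then have "snd a n = 1 mod P ^ n" "snd d n = 1 mod P ^ n"
    using t(6,7) zp_carrier_mod[OF zp_units_carrier[OF snd_qpx_units[OF t(2)]] assms]
      zp_carrier_mod[OF zp_units_carrier[OF snd_qpx_units[OF t(3)]] assms] by simp_all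
  then show "t \<in> tt_K P n" unfolding tt_K_def using t(1-5) by blast
qed

lemma tt_K_carrier: "tt_K P n \<subseteq> tt_carrier P"
  unfolding tt_K_def tt_carrier_def by auto

end

section \<open>Smooth irreducible representations\<close>

lemma irreducible_rep_schur:
  fixes scale :: "'k::field \<Rightarrow> 'v::ab_group_add \<Rightarrow> 'v"
  assumes "vector_space scale" and rep: "is_rep p scale \<rho>" and irr: "irreducible_rep p scale \<rho>"
    and C: "Vector_Spaces.linear scale scale C" and comm: "\<And>g. g \<in> tt_carrier p \<Longrightarrow> C \<circ> \<rho> g = \<rho> g \<circ> C"
  shows "C = (\<lambda>_. 0) \<or> bij C"
proof -
  interpret vector_space scale by fact
  interpret C: Vector_Spaces.linear scale scale C by (fact C)
  have invariant: "S = {0} \<or> S = UNIV" if "subspace S" "\<And>g v. g \<in> tt_carrier p \<Longrightarrow> v \<in> S \<Longrightarrow> \<rho> g v \<in> S" for S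
    using irr that unfolding irreducible_rep_def by blast
  have \<rho>_zero: "\<rho> g 0 = 0" if "g \<in> tt_carrier p" for g
  proof -
    interpret \<rho>g: Vector_Spaces.linear scale scale "\<rho> g" using rep that unfolding is_rep_def by blast
    show ?thesis by (rule \<rho>g.zero)
  qed
  have comm': "C (\<rho> g v) = \<rho> g (C v)" if "g \<in> tt_carrier p" for g v
    using comm[OF that] by (metis comp_apply)
  have "{v. C v = 0} = {0} \<or> {v. C v = 0} = UNIV"
    by (rule invariant[OF C.subspace_kernel]) (simp add: comm' \<rho>_zero)
  moreover have "range C = {0} \<or> range C = UNIV"
    by (rule invariant[OF C.subspace_image[OF subspace_UNIV]]) (auto simp: comm'[symmetric])
  ultimately show ?thesis
    using C.inj_iff_eq_0 by (auto simp: bij_def fun_eq_iff)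
qed

context odd_prime
begin

lemma rep_central_Z2_action:
  fixes scale :: "'k::field \<Rightarrow> 'v::ab_group_add \<Rightarrow> 'v"
  assumes vs: "vector_space scale" and rep: "is_rep P scale \<rho>" and irr: "irreducible_rep P scale \<rho>"
  shows "central_Z2_action scale (\<rho> ` tt_carrier P) (\<lambda>a b. \<rho> (tt_pdiag (2 * a) (2 * b)))"
proof (intro central_Z2_action.intro central_Z2_action_axioms.intro vs)
  have linear: "Vector_Spaces.linear scale scale (\<rho> g)" and mult: "\<rho> (tt_mul P g h) = \<rho> g \<circ> \<rho> h"
    if "g \<in> tt_carrier P" "h \<in> tt_carrier P" for g h
    using rep that unfolding is_rep_def by blast+
  show "Vector_Spaces.linear scale scale g" if "g \<in> \<rho> ` tt_carrier P" for g
    using that linear by blast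
  show "C = (\<lambda>_. 0) \<or> bij C"
    if "Vector_Spaces.linear scale scale C" "\<And>g. g \<in> \<rho> ` tt_carrier P \<Longrightarrow> C \<circ> g = g \<circ> C" for C
    using irreducible_rep_schur[OF vs rep irr that(1)] that(2) by blast
  show "Vector_Spaces.linear scale scale (\<rho> (tt_pdiag (2 * a) (2 * b)))" for a b
    using linear tt_pdiag_carrier by blast
  show "\<rho> (tt_pdiag (2 * a) (2 * b)) \<circ> g = g \<circ> \<rho> (tt_pdiag (2 * a) (2 * b))"
    if g_in: "g \<in> \<rho> ` tt_carrier P" for g a b
  proof -
    obtain h where h: "h \<in> tt_carrier P" and g: "g = \<rho> h" using g_in by blast
    have "\<rho> (tt_pdiag (2 * a) (2 * b)) \<circ> \<rho> h = \<rho> (tt_mul P (tt_pdiag (2 * a) (2 * b)) h)"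
      using mult[OF tt_pdiag_carrier h] by simp
    also have "\<dots> = \<rho> (tt_mul P h (tt_pdiag (2 * a) (2 * b)))" using tt_pdiag_central h by simp
    also have "\<dots> = \<rho> h \<circ> \<rho> (tt_pdiag (2 * a) (2 * b))" using mult[OF h tt_pdiag_carrier] .
    finally show ?thesis unfolding g .
  qed
  show "\<rho> (tt_pdiag (2 * (a + a')) (2 * (b + b'))) = \<rho> (tt_pdiag (2 * a) (2 * b)) \<circ> \<rho> (tt_pdiag (2 * a') (2 * b'))"
    for a a' b b'
  proof -
    have "tt_pdiag (2 * (a + a')) (2 * (b + b')) = tt_mul P (tt_pdiag (2 * a) (2 * b)) (tt_pdiag (2 * a') (2 * b'))"
      using tt_pdiag_add[of "2 * a" "2 * b" "2 * a'" "2 * b'"] by (simp add: distrib_left)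
    then show ?thesis using mult[OF tt_pdiag_carrier tt_pdiag_carrier] by simp
  qed
  show "\<rho> (tt_pdiag (2 * 0) (2 * 0)) = id"
    using rep unfolding is_rep_def by (simp add: tt_pdiag_0)
qed

lemma span_orbit_eq_UNIV:
  fixes scale :: "'k::field \<Rightarrow> 'v::ab_group_add \<Rightarrow> 'v"
  assumes "vector_space scale" and rep: "is_rep P scale \<rho>" and irr: "irreducible_rep P scale \<rho>"
    and "w \<noteq> 0"
  shows "module.span scale ((\<lambda>g. \<rho> g w) ` tt_carrier P) = UNIV"
proof -
  interpret vector_space scale by fact
  have linear: "\<And>g. g \<in> tt_carrier P \<Longrightarrow> Vector_Spaces.linear scale scale (\<rho> g)"
    and one: "\<rho> (tt_one P) = id"
    and mult: "\<And>g h. g \<in> tt_carrier P \<Longrightarrow> h \<in> tt_carrier P \<Longrightarrow> \<rho> (tt_mul P g h) = \<rho> g \<circ> \<rho> h"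
    using rep unfolding is_rep_def by auto
  let ?O = "(\<lambda>g. \<rho> g w) ` tt_carrier P"
  have "\<rho> g v \<in> span ?O" if g: "g \<in> tt_carrier P" and v: "v \<in> span ?O" for g v
    using v
  proof (induction rule: span_induct)
    interpret \<rho>g: Vector_Spaces.linear scale scale "\<rho> g" by (rule linear[OF g])
    show "subspace {v. \<rho> g v \<in> span ?O}"
      by (intro subspaceI) (simp_all add: \<rho>g.add \<rho>g.scale span_zero span_add span_scale)
  next
    case (step x)
    then obtain h where "h \<in> tt_carrier P" "x = \<rho> h w" by blast
    then have "\<rho> g x = \<rho> (tt_mul P g h) w" using mult[OF g] by simp
    moreover have "\<rho> (tt_mul P g h) w \<in> ?O" using tt_mul_carrier[OF g \<open>h \<in> tt_carrier P\<close>] by blast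
    ultimately show ?case by (simp add: span_base)
  qed
  moreover have "w \<in> span ?O" using tt_one_carrier one by (intro span_base image_eqI[where x = "tt_one P"]) simp_all
  ultimately show ?thesis
    using irr \<open>w \<noteq> 0\<close> unfolding irreducible_rep_def by (metis subspace_span singletonD)
qed

lemma span_central_translates_eq_UNIV:
  fixes scale :: "'k::field \<Rightarrow> 'v::ab_group_add \<Rightarrow> 'v"
  assumes vs: "vector_space scale" and rep: "is_rep P scale \<rho>" and irr: "irreducible_rep P scale \<rho>"
    and "w \<noteq> 0" and "1 \<le> n" and fixed: "\<And>t. t \<in> tt_K P n \<Longrightarrow> \<rho> t w = w"
  shows "module.span scale (\<Union>a b. \<rho> (tt_pdiag (2 * a) (2 * b)) ` (\<lambda>h. \<rho> h w) ` tt_reps n) = UNIV"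
proof -
  interpret vector_space scale by fact
  have mult: "\<And>g h. g \<in> tt_carrier P \<Longrightarrow> h \<in> tt_carrier P \<Longrightarrow> \<rho> (tt_mul P g h) = \<rho> g \<circ> \<rho> h"
    using rep unfolding is_rep_def by auto
  have "(\<lambda>g. \<rho> g w) ` tt_carrier P \<subseteq> (\<Union>a b. \<rho> (tt_pdiag (2 * a) (2 * b)) ` (\<lambda>h. \<rho> h w) ` tt_reps n)"
  proof clarify
    fix g assume "g \<in> tt_carrier P"
    then obtain a b h k where h: "h \<in> tt_reps n" and k: "k \<in> tt_K P n"
      and g: "g = tt_mul P (tt_pdiag (2 * a) (2 * b)) (tt_mul P h k)"
      using tt_decompose \<open>1 \<le> n\<close> by blast
    have "h \<in> tt_carrier P" "k \<in> tt_carrier P" using h k tt_reps_carrier tt_K_carrier by blast+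
    then have "\<rho> g w = \<rho> (tt_pdiag (2 * a) (2 * b)) (\<rho> h w)"
      unfolding g using fixed[OF k] by (simp add: mult tt_mul_carrier tt_pdiag_carrier)
    then show "\<rho> g w \<in> (\<Union>a b. \<rho> (tt_pdiag (2 * a) (2 * b)) ` (\<lambda>h. \<rho> h w) ` tt_reps n)"
      using h by blast
  qed
  then show ?thesis using span_orbit_eq_UNIV[OF vs rep irr \<open>w \<noteq> 0\<close>] span_mono by blast
qed

end

theorem lemma4p13:
  fixes p :: nat
    and scale :: "'k::field \<Rightarrow> 'v::ab_group_add \<Rightarrow> 'v"
    and \<rho> :: "ttilde \<Rightarrow> 'v \<Rightarrow> 'v"
  assumes "prime p" and "odd p"
    and "CHAR('k) = p" and "alg_closed TYPE('k)"
    and "vector_space scale"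
    and "is_rep (int p) scale \<rho>"
    and "smooth_rep (int p) \<rho>"
    and "irreducible_rep (int p) scale \<rho>"
    and "genuine_rep (int p) scale \<rho>"
  shows "finite_dim scale"
proof -
  interpret odd_prime p using assms(1,2) by unfold_locales
  interpret vector_space scale by fact
  interpret central: central_Z2_action scale "\<rho> ` tt_carrier P" "\<lambda>a b. \<rho> (tt_pdiag (2 * a) (2 * b))"
    using rep_central_Z2_action assms(5,6,8) .
  obtain w :: 'v where "w \<noteq> 0" using assms(8) unfolding irreducible_rep_def by blast
  obtain n0 where "\<forall>t \<in> tt_K P n0. \<rho> t w = w" using assms(7) unfolding smooth_rep_def by blast
  then have fixed: "\<rho> t w = w" if "t \<in> tt_K P (max n0 1)" for t
    using that tt_K_mono[of n0 "max n0 1"] by auto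
  define U where "U = (\<lambda>h. \<rho> h w) ` tt_reps (max n0 1)"
  have "finite U" unfolding U_def using finite_tt_reps by simp
  have "span (\<Union>a b. \<rho> (tt_pdiag (2 * a) (2 * b)) ` U) = UNIV"
    unfolding U_def using span_central_translates_eq_UNIV[OF assms(5,6,8) \<open>w \<noteq> 0\<close> _ fixed] by simp
  then have "span U = UNIV" by (rule central.span_eq_UNIV[OF assms(4) \<open>finite U\<close>])
  then show ?thesis unfolding finite_dim_def using \<open>finite U\<close> by blast
qed

end
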